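(* Let $(S,d_S)$ be a Polish metric space and let $(X_{t,T}:t\in\mathbb Z,T\in\mathbb N)$ be an $S$-valued locally stationary process with auxiliary process $(X_t(u):t\in\mathbb Z,u\in[0,1])$, where for each fixed $u$ the stationary process $(X_t(u))_{t\in\mathbb Z}$ is ergodic. For $u\in[0,1]$ and $A\in\mathcal B(S)$ let $$\mu_{T,u}(\omega,A)=\frac1T\sum_{t=1}^{\lfloor uT\rfloor}\delta_{X_{t,T}(\omega)}(A),\qquad \tilde\mu_u(A)=\int_0^u\mathbb P(X_0(\eta)\in A)\,d\eta .$$ Then, as $T\to\infty$, the sequence $(\mu_{T,u}:u\in[0,1])_{T\ge1}$ converges weakly in $D([0,1],\mathcal M_{+,\le1}(S))$ to $(\tilde\mu_u:u\in[0,1])$, which belongs to $C([0,1],\mathcal M_{+,\le1}(S))$ almost surely.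
   Context: Local stationarity: $(X_{t,T})$ is a triangular array (sample $t=1,\dots,T$, extended by $X_{t,T}=X_{1,T}$ for $t\le0$ and $X_{t,T}=X_{T,T}$ for $t\ge T$) of $S$-valued random variables on a common probability space, and it is locally stationary if there is an $S$-valued process $(X_t(u):t\in\mathbb Z,u\in[0,1])$ (the auxiliary process), stationary in $t$ for each fixed $u$, such that $\mathbb E[d_S(X_{t,T},X_t(t/T))\wedge1]=O(T^{-1})$ and $\mathbb E[d_S(X_t(u),X_t(v))\wedge1]=O(|u-v|)$, uniformly in $t=1,\dots,T$ and $u,v\in[0,1]$. $\mathcal M_{+,\le1}(S)$ is the space of nonnegative Borel measures on $S$ with total mass at most $1$, with the topology of weak convergence, metrized by $d_{BL}(\mu,\nu)=\sup\{|\int f\,d\mu-\int f\,d\nu|:\|f\|_{BL}\le1\}$, where $\|f\|_{BL}=\|f\|_\infty+\mathrm{Lip}(f)$. $D([0,1],\mathcal M_{+,\le1}(S))$ is the space of càdlàg functions with the Skorokhod $J_1$ topology; $C([0,1],\mathcal M_{+,\le1}(S))$ is the subspace of continuous functions with metric $\rho(\mu,\nu)=\sup_{u\in[0,1]}d_{BL}(\mu_u,\nu_u)$. *)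

theory Defs
  imports "HOL-Probability.Probability"
begin

section \<open>Sub-probability measures with the bounded Lipschitz metric\<close>

abbreviation subprobs :: "'a::topological_space measure set"
  where "subprobs \<equiv> space (subprob_algebra borel)"

text \<open>Both suprema are taken in \<^typ>\<open>ennreal\<close>, so the norm is infinite for functions that are
  not bounded and Lipschitz.  The pairs \<open>x = y\<close> contribute \<open>0 / 0 = 0\<close>.\<close>

definition bl_norm :: "('a::metric_space \<Rightarrow> real) \<Rightarrow> ennreal"
  where "bl_norm f = (SUP x. ennreal \<bar>f x\<bar>) + (SUP (x, y). ennreal (\<bar>f x - f y\<bar> / dist x y))"

definition bl_dist :: "'a::metric_space measure \<Rightarrow> 'a measure \<Rightarrow> real"
  where "bl_dist \<mu> \<nu> =
    enn2real (SUP f\<in>{f. bl_norm f \<le> 1}. ennreal \<bar>(\<integral>x. f x \<partial>\<mu>) - (\<integral>x. f x \<partial>\<nu>)\<bar>)"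

lemma bl_norm_le_1D:
  assumes "bl_norm f \<le> 1"
  shows "\<bar>f x\<bar> \<le> 1" "\<bar>f x - f y\<bar> \<le> dist x y"
proof -
  have "ennreal \<bar>f x\<bar> \<le> (SUP x. ennreal \<bar>f x\<bar>)"
    by (rule SUP_upper) simp
  also have "\<dots> \<le> bl_norm f" unfolding bl_norm_def by simp
  finally show "\<bar>f x\<bar> \<le> 1" using assms
    by (metis ennreal_1 ennreal_le_iff order_trans zero_le_one)
  have "ennreal (\<bar>f x - f y\<bar> / dist x y) \<le> (SUP (x, y). ennreal (\<bar>f x - f y\<bar> / dist x y))"
    by (rule SUP_upper2[of "(x, y)"]) auto
  also have "\<dots> \<le> bl_norm f" unfolding bl_norm_def by simp
  finally have "\<bar>f x - f y\<bar> / dist x y \<le> 1" using assms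
    by (metis ennreal_1 ennreal_le_iff order_trans zero_le_one)
  then show "\<bar>f x - f y\<bar> \<le> dist x y"
    by (cases "x = y") (auto simp: divide_simps split: if_splits)
qed

lemma bl_norm_le_1I:
  assumes "\<And>x. \<bar>f x\<bar> \<le> a" "\<And>x y. \<bar>f x - f y\<bar> \<le> b * dist x y" "0 \<le> b" "a + b \<le> 1"
  shows "bl_norm f \<le> 1"
proof -
  have "0 \<le> a" using assms(1) by (meson abs_ge_zero order_trans)
  have "(SUP x. ennreal \<bar>f x\<bar>) \<le> ennreal a"
    by (rule SUP_least) (simp add: assms ennreal_leI)
  moreover have "(SUP (x, y). ennreal (\<bar>f x - f y\<bar> / dist x y)) \<le> ennreal b"
  proof (rule SUP_least, clarify)
    fix x y
    have "\<bar>f x - f y\<bar> / dist x y \<le> b"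
      using assms(2)[of x y] assms(3) by (cases "x = y") (auto simp: divide_simps mult.commute)
    then show "ennreal (\<bar>f x - f y\<bar> / dist x y) \<le> ennreal b" by (rule ennreal_leI)
  qed
  ultimately have "bl_norm f \<le> ennreal a + ennreal b"
    unfolding bl_norm_def by (rule add_mono)
  also have "\<dots> = ennreal (a + b)" using \<open>0 \<le> a\<close> \<open>0 \<le> b\<close> by (simp add: ennreal_plus)
  also have "\<dots> \<le> 1" using assms(4) by (metis ennreal_1 ennreal_leI)
  finally show ?thesis .
qed

lemma bl_norm_borel [measurable_dest]:
  fixes f :: "'a::metric_space \<Rightarrow> real"
  assumes "bl_norm f \<le> 1"
  shows "f \<in> borel_measurable borel"
proof (rule borel_measurable_continuous_onI)
  have "1-lipschitz_on UNIV f"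
    using bl_norm_le_1D(2)[OF assms] by (intro lipschitz_onI) (auto simp: dist_real_def)
  then show "continuous_on UNIV f" by (rule lipschitz_on_continuous_on)
qed

lemma bl_norm_integrable:
  assumes "bl_norm f \<le> 1" "\<mu> \<in> subprobs"
  shows "integrable \<mu> f" "\<bar>\<integral>x. f x \<partial>\<mu>\<bar> \<le> 1"
proof -
  interpret subprob_space \<mu> using assms(2) by (simp add: space_subprob_algebra)
  have [measurable_cong]: "sets \<mu> = sets borel" using assms(2) by (simp add: space_subprob_algebra)
  have [measurable]: "f \<in> borel_measurable \<mu>" using bl_norm_borel[OF assms(1)] by measurable
  show i: "integrable \<mu> f"
    by (rule integrable_const_bound[of _ 1]) (use bl_norm_le_1D(1)[OF assms(1)] in auto)
  have "\<bar>\<integral>x. f x \<partial>\<mu>\<bar> \<le> (\<integral>x. \<bar>f x\<bar> \<partial>\<mu>)" by (rule integral_abs_bound)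
  also have "\<dots> \<le> (\<integral>x. 1 \<partial>\<mu>)"
    by (rule integral_mono) (use i bl_norm_le_1D(1)[OF assms(1)] in auto)
  also have "\<dots> \<le> 1" using subprob_measure_le_1 by simp
  finally show "\<bar>\<integral>x. f x \<partial>\<mu>\<bar> \<le> 1" .
qed

lemma bl_dist_nonneg: "0 \<le> bl_dist \<mu> \<nu>"
  by (simp add: bl_dist_def)

lemma bl_dist_commute: "bl_dist \<mu> \<nu> = bl_dist \<nu> \<mu>"
  by (simp add: bl_dist_def abs_minus_commute)

lemma bl_dist_le:
  assumes "\<And>f. bl_norm f \<le> 1 \<Longrightarrow> \<bar>(\<integral>x. f x \<partial>\<mu>) - (\<integral>x. f x \<partial>\<nu>)\<bar> \<le> c" "0 \<le> c"
  shows "bl_dist \<mu> \<nu> \<le> c"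
  unfolding bl_dist_def
  by (rule enn2real_leI) (auto intro!: SUP_least ennreal_leI assms)

lemma bl_dist_ge:
  assumes "\<mu> \<in> subprobs" "\<nu> \<in> subprobs" "bl_norm f \<le> 1"
  shows "\<bar>(\<integral>x. f x \<partial>\<mu>) - (\<integral>x. f x \<partial>\<nu>)\<bar> \<le> bl_dist \<mu> \<nu>"
proof -
  let ?S = "SUP f\<in>{f. bl_norm f \<le> 1}. ennreal \<bar>(\<integral>x. f x \<partial>\<mu>) - (\<integral>x. f x \<partial>\<nu>)\<bar>"
  have "?S \<le> ennreal 2"
  proof (rule SUP_least, rule ennreal_leI)
    fix g assume "g \<in> {f::'a \<Rightarrow> real. bl_norm f \<le> 1}"
    then show "\<bar>(\<integral>x. g x \<partial>\<mu>) - (\<integral>x. g x \<partial>\<nu>)\<bar> \<le> 2"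
      using bl_norm_integrable(2)[of g \<mu>] bl_norm_integrable(2)[of g \<nu>] assms by auto
  qed
  then have fin: "?S < top" using ennreal_less_top le_less_trans by blast
  have "ennreal \<bar>(\<integral>x. f x \<partial>\<mu>) - (\<integral>x. f x \<partial>\<nu>)\<bar> \<le> ?S"
    by (rule SUP_upper) (use assms in auto)
  then have "enn2real (ennreal \<bar>(\<integral>x. f x \<partial>\<mu>) - (\<integral>x. f x \<partial>\<nu>)\<bar>) \<le> enn2real ?S"
    using fin by (rule enn2real_mono)
  then show ?thesis by (simp add: bl_dist_def)
qed

lemma bl_dist_le_2:
  assumes "\<mu> \<in> subprobs" "\<nu> \<in> subprobs"
  shows "bl_dist \<mu> \<nu> \<le> 2"
proof (rule bl_dist_le)
  fix g :: "'a \<Rightarrow> real" assume "bl_norm g \<le> 1"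
  then show "\<bar>(\<integral>x. g x \<partial>\<mu>) - (\<integral>x. g x \<partial>\<nu>)\<bar> \<le> 2"
    using bl_norm_integrable(2)[of g \<mu>] bl_norm_integrable(2)[of g \<nu>] assms by auto
qed simp

definition closed_approx :: "'a::metric_space set \<Rightarrow> nat \<Rightarrow> 'a \<Rightarrow> real"
  where "closed_approx F n x = max 0 (1 - real n * infdist x F)"

lemma closed_approx_bounds: "0 \<le> closed_approx F n x" "closed_approx F n x \<le> 1"
  by (auto simp: closed_approx_def infdist_nonneg)

lemma closed_approx_lipschitz:
  "\<bar>closed_approx F n x - closed_approx F n y\<bar> \<le> real n * dist x y"
proof -
  have "\<bar>closed_approx F n x - closed_approx F n y\<bar> \<le> \<bar>real n * infdist x F - real n * infdist y F\<bar>"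
    unfolding closed_approx_def by linarith
  also have "\<dots> = real n * \<bar>infdist x F - infdist y F\<bar>"
    by (simp add: abs_mult flip: right_diff_distrib)
  also have "\<dots> \<le> real n * dist x y"
    by (intro mult_left_mono infdist_triangle_abs) auto
  finally show ?thesis .
qed

lemma closed_approx_borel [measurable]: "closed_approx F n \<in> borel_measurable borel"
  unfolding closed_approx_def
  by (intro borel_measurable_continuous_onI continuous_intros)

lemma closed_approx_bl:
  "bl_norm (\<lambda>x. closed_approx F n x / (1 + real n)) \<le> 1"
proof (rule bl_norm_le_1I[where a="1 / (1 + real n)" and b="real n / (1 + real n)"])
  fix x y
  show "\<bar>closed_approx F n x / (1 + real n)\<bar> \<le> 1 / (1 + real n)"
    using closed_approx_bounds[of F n x] by (simp add: divide_right_mono)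
  have "\<bar>closed_approx F n x / (1 + real n) - closed_approx F n y / (1 + real n)\<bar>
      = \<bar>closed_approx F n x - closed_approx F n y\<bar> / (1 + real n)"
    by (simp flip: diff_divide_distrib)
  also have "\<dots> \<le> real n * dist x y / (1 + real n)"
    by (intro divide_right_mono closed_approx_lipschitz) auto
  finally show "\<bar>closed_approx F n x / (1 + real n) - closed_approx F n y / (1 + real n)\<bar>
      \<le> real n / (1 + real n) * dist x y" by simp
qed (auto simp flip: add_divide_distrib)

lemma closed_approx_LIMSEQ:
  assumes "closed F" "F \<noteq> {}"
  shows "(\<lambda>n. closed_approx F n x) \<longlonglongrightarrow> indicator F x"
proof (cases "x \<in> F")
  case True
  then show ?thesis by (simp add: closed_approx_def)
next
  case False
  then have pos: "infdist x F > 0" using infdist_pos_not_in_closed[OF assms] by simp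
  obtain N :: nat where N: "1 / infdist x F < real N" using reals_Archimedean2 by blast
  have "closed_approx F n x = 0" if "n \<ge> N" for n
  proof -
    have "1 / infdist x F < real n" using N that by (meson of_nat_mono less_le_trans)
    then have "1 < real n * infdist x F" using pos by (simp add: field_simps)
    then show ?thesis by (simp add: closed_approx_def)
  qed
  then have "eventually (\<lambda>n. closed_approx F n x = indicator F x) sequentially"
    using False by (auto simp: eventually_sequentially)
  then show ?thesis by (rule tendsto_eventually)
qed

lemma closed_approx_integral_LIMSEQ:
  assumes "finite_measure \<mu>" "sets \<mu> = sets borel" "closed F" "F \<noteq> {}"
  shows "(\<lambda>n. \<integral>x. closed_approx F n x \<partial>\<mu>) \<longlonglongrightarrow> measure \<mu> F"
proof -
  interpret finite_measure \<mu> by fact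
  have [measurable_cong]: "sets \<mu> = sets borel" by fact
  have F: "F \<in> sets \<mu>" using assms by simp
  have "(\<lambda>n. \<integral>x. closed_approx F n x \<partial>\<mu>) \<longlonglongrightarrow> (\<integral>x. indicator F x \<partial>\<mu>)"
  proof (rule integral_dominated_convergence[where w="\<lambda>_. 1"])
    show "AE x in \<mu>. (\<lambda>n. closed_approx F n x) \<longlonglongrightarrow> indicator F x"
      using closed_approx_LIMSEQ[OF assms(3,4)] by simp
    show "AE x in \<mu>. norm (closed_approx F n x) \<le> 1" for n
      by (rule AE_I2) (simp add: closed_approx_bounds)
  qed (use F in auto)
  also have "(\<integral>x. indicator F x \<partial>\<mu>) = measure \<mu> F"
    using F by (simp add: emeasure_eq_measure)
  finally show ?thesis .
qed

lemma bl_dist_eq_0_iff: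
  assumes "\<mu> \<in> subprobs" "\<nu> \<in> subprobs"
  shows "bl_dist \<mu> \<nu> = 0 \<longleftrightarrow> \<mu> = \<nu>"
proof
  assume 0: "bl_dist \<mu> \<nu> = 0"
  have \<mu>: "subprob_space \<mu>" "sets \<mu> = sets borel" and \<nu>: "subprob_space \<nu>" "sets \<nu> = sets borel"
    using assms by (auto simp: space_subprob_algebra)
  interpret \<mu>: subprob_space \<mu> by fact
  interpret \<nu>: subprob_space \<nu> by fact
  have eq: "measure \<mu> F = measure \<nu> F" if "closed F" for F
  proof (cases "F = {}")
    case False
    have "(\<integral>x. closed_approx F n x \<partial>\<mu>) = (\<integral>x. closed_approx F n x \<partial>\<nu>)" for n
    proof -
      have "\<bar>(\<integral>x. closed_approx F n x / (1 + real n) \<partial>\<mu>)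
          - (\<integral>x. closed_approx F n x / (1 + real n) \<partial>\<nu>)\<bar> \<le> 0"
        using bl_dist_ge[OF assms closed_approx_bl[of F n]] 0 by simp
      then show ?thesis by simp
    qed
    then show ?thesis
      using closed_approx_integral_LIMSEQ[OF \<mu>.finite_measure_axioms \<mu>(2) that False]
        closed_approx_integral_LIMSEQ[OF \<nu>.finite_measure_axioms \<nu>(2) that False]
      by (simp add: LIMSEQ_unique)
  qed simp
  show "\<mu> = \<nu>"
  proof (rule measure_eqI_generator_eq[where E="Collect closed" and \<Omega>=UNIV and A="\<lambda>_. UNIV"])
    show "Int_stable (Collect closed :: 'a set set)" by (auto simp: Int_stable_def)
    show "sets \<mu> = sigma_sets UNIV (Collect closed)" "sets \<nu> = sigma_sets UNIV (Collect closed)"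
      using \<mu> \<nu> by (simp_all add: borel_eq_closed)
  qed (auto simp: eq \<mu>.emeasure_eq_measure \<nu>.emeasure_eq_measure)
next
  assume "\<mu> = \<nu>"
  then have "bl_dist \<mu> \<nu> \<le> 0" by (intro bl_dist_le) auto
  then show "bl_dist \<mu> \<nu> = 0" using bl_dist_nonneg[of \<mu> \<nu>] by simp
qed

lemma bl_dist_triangle:
  assumes "\<mu> \<in> subprobs" "\<nu> \<in> subprobs" "\<kappa> \<in> subprobs"
  shows "bl_dist \<mu> \<kappa> \<le> bl_dist \<mu> \<nu> + bl_dist \<nu> \<kappa>"
proof (rule bl_dist_le)
  fix f :: "'a \<Rightarrow> real" assume f: "bl_norm f \<le> 1"
  show "\<bar>(\<integral>x. f x \<partial>\<mu>) - (\<integral>x. f x \<partial>\<kappa>)\<bar> \<le> bl_dist \<mu> \<nu> + bl_dist \<nu> \<kappa>"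
    using bl_dist_ge[OF assms(1,2) f] bl_dist_ge[OF assms(2,3) f] by linarith
qed (simp add: bl_dist_nonneg)

lemma Metric_space_bl_dist: "Metric_space subprobs bl_dist"
proof
  fix \<mu> \<nu> \<kappa> :: "'a measure"
  show "0 \<le> bl_dist \<mu> \<nu>" by (rule bl_dist_nonneg)
  show "bl_dist \<mu> \<nu> = bl_dist \<nu> \<mu>" by (rule bl_dist_commute)
  show "\<mu> \<in> subprobs \<Longrightarrow> \<nu> \<in> subprobs \<Longrightarrow> bl_dist \<mu> \<nu> = 0 \<longleftrightarrow> \<mu> = \<nu>"
    by (rule bl_dist_eq_0_iff)
  show "\<mu> \<in> subprobs \<Longrightarrow> \<nu> \<in> subprobs \<Longrightarrow> \<kappa> \<in> subprobs \<Longrightarrow>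
      bl_dist \<mu> \<kappa> \<le> bl_dist \<mu> \<nu> + bl_dist \<nu> \<kappa>"
    by (rule bl_dist_triangle)
qed

abbreviation bl_topology :: "'a::metric_space measure topology"
  where "bl_topology \<equiv> Metric_space.mtopology subprobs bl_dist"


section \<open>The Skorokhod space on the unit interval\<close>

text \<open>Paths are total functions on the reals that are \<^const>\<open>undefined\<close> off the unit interval,
  so that a path is determined by its restriction to the unit interval.\<close>

definition cadlag_paths :: "'b topology \<Rightarrow> (real \<Rightarrow> 'b) set"
  where "cadlag_paths Y =
    {x \<in> {0..1} \<rightarrow>\<^sub>E topspace Y.
       (\<forall>t\<in>{0..<1}. limitin Y x (x t) (at_right t)) \<and>
       (\<forall>t\<in>{0<..1}. \<exists>l. limitin Y x l (at_left t))}"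

definition continuous_paths :: "'b topology \<Rightarrow> (real \<Rightarrow> 'b) set"
  where "continuous_paths Y =
    {x \<in> {0..1} \<rightarrow>\<^sub>E topspace Y. continuous_map (top_of_set {0..1}) Y x}"

definition time_changes :: "(real \<Rightarrow> real) set"
  where "time_changes =
    {l. continuous_on {0..1} l \<and> strict_mono_on {0..1} l \<and> l ` {0..1} = {0..1}}"

definition skorokhod_dist :: "('b \<Rightarrow> 'b \<Rightarrow> real) \<Rightarrow> (real \<Rightarrow> 'b) \<Rightarrow> (real \<Rightarrow> 'b) \<Rightarrow> real"
  where "skorokhod_dist d x y =
    enn2real (INF l\<in>time_changes.
      max (SUP t\<in>{0..1}. ennreal \<bar>l t - t\<bar>) (SUP t\<in>{0..1}. ennreal (d (x t) (y (l t)))))"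

lemma time_changes_id: "(\<lambda>t. t) \<in> time_changes"
  by (auto simp: time_changes_def strict_mono_on_def)

lemma time_changes_mem: "l \<in> time_changes \<Longrightarrow> t \<in> {0..1} \<Longrightarrow> l t \<in> {0..1}"
  unfolding time_changes_def by blast

lemma time_changes_comp:
  assumes "l \<in> time_changes" "k \<in> time_changes"
  shows "(\<lambda>t. k (l t)) \<in> time_changes"
proof -
  have l: "continuous_on {0..1} l" "strict_mono_on {0..1} l" "l ` {0..1} = {0..1}"
    and k: "continuous_on {0..1} k" "strict_mono_on {0..1} k" "k ` {0..1} = {0..1}"
    using assms by (simp_all add: time_changes_def)
  have "continuous_on {0..1} (\<lambda>t. k (l t))"
    by (rule continuous_on_compose2[OF k(1) l(1)]) (simp add: l(3))
  moreover have "strict_mono_on {0..1} (\<lambda>t. k (l t))"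
    by (intro strict_mono_onI strict_mono_onD[OF k(2)] strict_mono_onD[OF l(2)]
        time_changes_mem[OF assms(1)])
  moreover have "(\<lambda>t. k (l t)) ` {0..1} = {0..1}"
    by (simp add: l(3) k(3) flip: image_image[of k l])
  ultimately show ?thesis by (simp add: time_changes_def)
qed

lemma time_changes_1:
  assumes "l \<in> time_changes" shows "l 1 = 1"
proof -
  have l: "strict_mono_on {0..1} l" "l ` {0..1} = {0..1}"
    using assms by (simp_all add: time_changes_def)
  have "1 \<in> l ` {0..1}" unfolding l(2) by simp
  then obtain s where s: "s \<in> {0..1}" "l s = 1" by (metis imageE)
  show ?thesis
  proof (cases "s = 1")
    case False
    then have "l s < l 1" using s by (intro strict_mono_onD[OF l(1)]) auto
    then show ?thesis using s time_changes_mem[OF assms, of 1] by auto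
  qed (use s in auto)
qed

lemma time_changes_inverse:
  assumes "l \<in> time_changes"
  obtains k where "k \<in> time_changes"
    "\<And>t. t \<in> {0..1} \<Longrightarrow> k (l t) = t" "\<And>t. t \<in> {0..1} \<Longrightarrow> l (k t) = t"
proof -
  let ?k = "inv_into {0..1} l"
  have l: "continuous_on {0..1} l" "strict_mono_on {0..1} l" "l ` {0..1} = {0..1}"
    using assms by (simp_all add: time_changes_def)
  have inj: "inj_on l {0..1}" using l(2) by (rule strict_mono_on_imp_inj_on)
  have kl: "?k (l t) = t" if "t \<in> {0..1}" for t using inj that by simp
  have lk: "l (?k t) = t" if "t \<in> {0..1}" for t using l(3) that by (simp add: f_inv_into_f)
  have mem: "?k t \<in> {0..1}" if "t \<in> {0..1}" for t using l(3) that by (metis inv_into_into)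
  have "continuous_on (l ` {0..1}) ?k"
    by (rule continuous_on_inv) (use l kl in auto)
  moreover have "strict_mono_on {0..1} ?k"
  proof (rule strict_mono_onI)
    fix r s :: real assume rs: "r \<in> {0..1}" "s \<in> {0..1}" "r < s"
    show "?k r < ?k s"
    proof (rule ccontr)
      assume "\<not> ?k r < ?k s"
      then have "?k s < ?k r \<or> ?k s = ?k r" by auto
      then have "l (?k s) \<le> l (?k r)"
        using strict_mono_onD[OF l(2) mem[OF rs(2)] mem[OF rs(1)]] by auto
      then show False using lk rs by auto
    qed
  qed
  moreover have "?k ` {0..1} = {0..1}"
  proof
    show "?k ` {0..1} \<subseteq> {0..1}" using mem by (intro image_subsetI)
    show "{0..1} \<subseteq> ?k ` {0..1}"
      using kl time_changes_mem[OF assms] by (intro subsetI) (metis imageI)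
  qed
  ultimately have "?k \<in> time_changes" using l(3) by (simp add: time_changes_def)
  then show ?thesis using that kl lk by blast
qed

lemma skorokhod_dist_le:
  assumes "l \<in> time_changes" "\<And>t. t \<in> {0..1} \<Longrightarrow> \<bar>l t - t\<bar> \<le> c"
    "\<And>t. t \<in> {0..1} \<Longrightarrow> d (x t) (y (l t)) \<le> c"
  shows "skorokhod_dist d x y \<le> c"
proof -
  have "0 \<le> c" using assms(2)[of 0] by auto
  show ?thesis unfolding skorokhod_dist_def
  proof (rule enn2real_leI[OF \<open>0 \<le> c\<close>], rule INF_lower2[OF assms(1)])
    show "max (SUP t\<in>{0..1}. ennreal \<bar>l t - t\<bar>) (SUP t\<in>{0..1}. ennreal (d (x t) (y (l t)))) \<le> ennreal c"
      using assms by (auto intro!: SUP_least ennreal_leI simp del: atLeastAtMost_iff)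
  qed
qed

lemma skorokhod_dist_less:
  assumes "skorokhod_dist d x y < e"
    and bdd: "\<And>s t. s \<in> {0..1} \<Longrightarrow> t \<in> {0..1} \<Longrightarrow> d (x s) (y t) \<le> B"
  obtains l where "l \<in> time_changes" "\<And>t. t \<in> {0..1} \<Longrightarrow> \<bar>l t - t\<bar> < e"
    "\<And>t. t \<in> {0..1} \<Longrightarrow> d (x t) (y (l t)) < e"
proof -
  let ?F = "\<lambda>l. max (SUP t\<in>{0..1}. ennreal \<bar>l t - t\<bar>) (SUP t\<in>{0..1}. ennreal (d (x t) (y (l t))))"
  have e: "0 < e" using assms(1) by (simp add: skorokhod_dist_def order_le_less_trans[OF enn2real_nonneg])
  have "(INF l\<in>time_changes. ?F l) \<le> ?F (\<lambda>t. t)" by (rule INF_lower[OF time_changes_id])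
  also have "\<dots> \<le> ennreal (max 0 B)"
    by (auto intro!: SUP_least ennreal_leI bdd max.coboundedI2)
  also have "\<dots> < top" by simp
  finally have fin: "(INF l\<in>time_changes. ?F l) < top" .
  then have "(INF l\<in>time_changes. ?F l) = ennreal (skorokhod_dist d x y)"
    by (simp add: skorokhod_dist_def)
  also have "\<dots> < ennreal e" using assms(1) e by (simp add: ennreal_lessI)
  finally obtain l where l: "l \<in> time_changes" "?F l < ennreal e" by (auto simp: INF_less_iff)
  show ?thesis
  proof (rule that[OF l(1)])
    fix t :: real assume t: "t \<in> {0..1}"
    have "ennreal \<bar>l t - t\<bar> \<le> ?F l" using t by (auto intro!: max.coboundedI1 SUP_upper)
    then have "ennreal \<bar>l t - t\<bar> < ennreal e" using l(2) by (rule le_less_trans)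
    then show "\<bar>l t - t\<bar> < e" by (simp add: ennreal_less_iff)
    have "ennreal (d (x t) (y (l t))) \<le> ?F l"
      using t by (intro max.coboundedI2) (auto intro!: SUP_upper)
    then have "ennreal (d (x t) (y (l t))) < ennreal e" using l(2) by (rule le_less_trans)
    then show "d (x t) (y (l t)) < e"
      using ennreal_leI[of e "d (x t) (y (l t))"] by (meson not_less)
  qed
qed

lemma Metric_space_skorokhod_dist:
  assumes "Metric_space M d" and B: "\<And>a b. a \<in> M \<Longrightarrow> b \<in> M \<Longrightarrow> d a b \<le> B"
  shows "Metric_space (cadlag_paths (Metric_space.mtopology M d)) (skorokhod_dist d)"
proof -
  interpret Metric_space M d by fact
  let ?D = "cadlag_paths mtopology"
  have mem: "x t \<in> M" if "x \<in> ?D" "t \<in> {0..1}" for x t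
    using that by (auto simp: cadlag_paths_def)
  show ?thesis
  proof
    fix x y :: "real \<Rightarrow> 'a"
    show "0 \<le> skorokhod_dist d x y" by (simp add: skorokhod_dist_def)
    let ?F = "\<lambda>x y l. max (SUP t\<in>{0..1}. ennreal \<bar>l t - t\<bar>) (SUP t\<in>{0..1}. ennreal (d (x t) (y (l t))))"
    have le: "(INF l\<in>time_changes. ?F x y l) \<le> (INF l\<in>time_changes. ?F y x l)" for x y :: "real \<Rightarrow> 'a"
    proof (rule INF_greatest)
      fix l assume l: "l \<in> time_changes"
      obtain k where k: "k \<in> time_changes" "\<And>t. t \<in> {0..1} \<Longrightarrow> k (l t) = t"
        "\<And>t. t \<in> {0..1} \<Longrightarrow> l (k t) = t"
        using time_changes_inverse[OF l] by blast
      have "?F x y k \<le> ?F y x l"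
      proof (rule max.mono; rule SUP_least)
        fix t :: real assume t: "t \<in> {0..1}"
        show "ennreal \<bar>k t - t\<bar> \<le> (SUP t\<in>{0..1}. ennreal \<bar>l t - t\<bar>)"
          by (rule SUP_upper2[of "k t"])
            (use k(3)[OF t] time_changes_mem[OF k(1) t] in \<open>auto simp: abs_minus_commute\<close>)
        show "ennreal (d (x t) (y (k t))) \<le> (SUP t\<in>{0..1}. ennreal (d (y t) (x (l t))))"
          by (rule SUP_upper2[of "k t"])
            (use k(3)[OF t] time_changes_mem[OF k(1) t] in \<open>auto simp: commute\<close>)
      qed
      then show "(INF l\<in>time_changes. ?F x y l) \<le> ?F y x l"
        by (rule INF_lower2[OF k(1)])
    qed
    show "skorokhod_dist d x y = skorokhod_dist d y x"
      unfolding skorokhod_dist_def by (rule arg_cong[OF antisym[OF le le]])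
  next
    fix x y assume x: "x \<in> ?D" and y: "y \<in> ?D"
    show "skorokhod_dist d x y = 0 \<longleftrightarrow> x = y"
    proof
      assume "x = y"
      then have "skorokhod_dist d x y \<le> 0"
        by (intro skorokhod_dist_le[OF time_changes_id]) (use mem[OF y] in auto)
      then show "skorokhod_dist d x y = 0" by (simp add: skorokhod_dist_def antisym)
    next
      assume 0: "skorokhod_dist d x y = 0"
      have tc: "\<exists>l\<in>time_changes. \<forall>t\<in>{0..1}. \<bar>l t - t\<bar> < e \<and> d (x t) (y (l t)) < e" if "e > 0" for e
        using skorokhod_dist_less[of d x y e B] 0 that B mem x y by metis
      have eq: "x t = y t" if t: "t \<in> {0..1}" for t
      proof (cases "t = 1")
        case True
        have "d (x 1) (y 1) \<le> 0"
        proof (rule field_le_epsilon)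
          fix e :: real assume "e > 0"
          from tc[OF this] obtain l where l: "l \<in> time_changes" "d (x 1) (y (l 1)) < e"
            by auto
          then show "d (x 1) (y 1) \<le> 0 + e" using time_changes_1[OF l(1)] by simp
        qed
        then have "d (x 1) (y 1) = 0" using nonneg by (rule antisym)
        then show ?thesis
          using mem[OF x, of 1] mem[OF y, of 1] True by simp
      next
        case False
        then have t1: "t \<in> {0..<1}" using t by auto
        have "d (x t) (y t) \<le> 0"
        proof (rule field_le_epsilon)
          fix e :: real assume e: "e > 0"
          have rc: "eventually (\<lambda>s. z s \<in> M \<and> d (z s) (z t) < e / 3) (at_right t)" if "z \<in> ?D" for z
          proof -
            have "limitin mtopology z (z t) (at_right t)"
              using that t1 unfolding cadlag_paths_def by blast
            moreover have "0 < e / 3" using e by simp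
            ultimately show ?thesis unfolding limitin_metric by blast
          qed
          have "eventually (\<lambda>s. (x s \<in> M \<and> d (x s) (x t) < e / 3) \<and> (y s \<in> M \<and> d (y s) (y t) < e / 3)) (at_right t)"
            using rc[OF x] rc[OF y] by (rule eventually_conj)
          then obtain b where b: "b > t" "\<And>s. t < s \<Longrightarrow> s < b \<Longrightarrow>
              d (x s) (x t) < e / 3 \<and> d (y s) (y t) < e / 3"
            unfolding eventually_at_right_field by blast
          define c where "c = min b 1"
          define s where "s = (t + c) / 2"
          have s: "t < s" "s < c" "c \<le> b" "c \<le> 1" "s \<in> {0..1}"
            using b(1) t1 by (auto simp: s_def c_def)
          obtain l where l: "l \<in> time_changes" "\<bar>l s - s\<bar> < min (e / 3) (s - t)" "d (x s) (y (l s)) < min (e / 3) (s - t)"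
            using tc[of "min (e / 3) (s - t)"] e s by auto
          have "s - t = c - s" by (simp add: s_def field_simps)
          moreover have "\<bar>l s - s\<bar> < s - t" using l(2) by simp
          ultimately have "t < l s" "l s < b" using s(3) by linarith+
          then have "d (y (l s)) (y t) < e / 3" "d (x s) (x t) < e / 3" using b(2) s by auto
          moreover have "d (x t) (y t) \<le> d (x t) (x s) + d (x s) (y t)"
            "d (x s) (y t) \<le> d (x s) (y (l s)) + d (y (l s)) (y t)"
            using mem[OF x] mem[OF y] t s(5) time_changes_mem[OF l(1) s(5)] by (auto intro!: triangle)
          ultimately show "d (x t) (y t) \<le> 0 + e" using l(3) by (simp add: commute)
        qed
        then have "d (x t) (y t) = 0" using nonneg by (rule antisym)
        then show ?thesis using mem[OF x t] mem[OF y t] by simp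
      qed
      show "x = y"
        by (rule PiE_ext[of x "{0..1}" "\<lambda>_. M" y]) (use x y eq in \<open>auto simp: cadlag_paths_def\<close>)
    qed
  next
    fix x y z assume x: "x \<in> ?D" and y: "y \<in> ?D" and z: "z \<in> ?D"
    show "skorokhod_dist d x z \<le> skorokhod_dist d x y + skorokhod_dist d y z"
    proof (rule field_le_epsilon)
      fix e :: real assume e: "e > 0"
      let ?a = "skorokhod_dist d x y + e / 2" and ?b = "skorokhod_dist d y z + e / 2"
      obtain l where l: "l \<in> time_changes" "\<And>t. t \<in> {0..1} \<Longrightarrow> \<bar>l t - t\<bar> < ?a"
        "\<And>t. t \<in> {0..1} \<Longrightarrow> d (x t) (y (l t)) < ?a"
        by (rule skorokhod_dist_less[of d x y ?a B]) (use e B mem x y in auto)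
      obtain k where k: "k \<in> time_changes" "\<And>t. t \<in> {0..1} \<Longrightarrow> \<bar>k t - t\<bar> < ?b"
        "\<And>t. t \<in> {0..1} \<Longrightarrow> d (y t) (z (k t)) < ?b"
        by (rule skorokhod_dist_less[of d y z ?b B]) (use e B mem y z in auto)
      show "skorokhod_dist d x z \<le> skorokhod_dist d x y + skorokhod_dist d y z + e"
      proof (rule skorokhod_dist_le[OF time_changes_comp[OF l(1) k(1)]])
        fix t :: real assume t: "t \<in> {0..1}"
        note lt = time_changes_mem[OF l(1) t] and klt = time_changes_mem[OF k(1) time_changes_mem[OF l(1) t]]
        show "\<bar>k (l t) - t\<bar> \<le> skorokhod_dist d x y + skorokhod_dist d y z + e"
          using l(2)[OF t] k(2)[OF lt] by linarith
        have "d (x t) (z (k (l t))) \<le> d (x t) (y (l t)) + d (y (l t)) (z (k (l t)))"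
          using triangle mem[OF x t] mem[OF y lt] mem[OF z klt] by blast
        then show "d (x t) (z (k (l t))) \<le> skorokhod_dist d x y + skorokhod_dist d y z + e"
          using l(3)[OF t] k(3)[OF lt] by linarith
      qed
    qed
  qed
qed

text \<open>\<open>D([0,1], M)\<close> for the space \<open>M\<close> of sub-probability measures, with the \<open>J1\<close> topology, and
  its subset \<open>C([0,1], M)\<close>.\<close>

abbreviation skorokhod_topology :: "(real \<Rightarrow> 'a::metric_space measure) topology"
  where "skorokhod_topology \<equiv> Metric_space.mtopology (cadlag_paths bl_topology) (skorokhod_dist bl_dist)"

lemma Metric_space_skorokhod: "Metric_space (cadlag_paths bl_topology) (skorokhod_dist bl_dist)"
  by (rule Metric_space_skorokhod_dist[OF Metric_space_bl_dist bl_dist_le_2])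

lemma topspace_bl_topology: "topspace bl_topology = subprobs"
  by (rule Metric_space.topspace_mtopology[OF Metric_space_bl_dist])

lemma topspace_skorokhod_topology: "topspace skorokhod_topology = cadlag_paths bl_topology"
  by (rule Metric_space.topspace_mtopology[OF Metric_space_skorokhod])

lemma continuous_paths_subset_cadlag_paths: "continuous_paths Y \<subseteq> cadlag_paths Y"
proof
  fix x assume x: "x \<in> continuous_paths Y"
  then have c: "continuous_map (top_of_set {0..1}) Y x" and e: "x \<in> {0..1} \<rightarrow>\<^sub>E topspace Y"
    by (auto simp: continuous_paths_def)
  have *: "limitin Y x (x t) (at t within {0..1})" if "t \<in> {0..1}" for t
  proof -
    have "limitin (top_of_set {0..1}) (\<lambda>s. s) t (at t within {0..1})"
      using that by (auto simp: limitin_subtopology tendsto_ident_at eventually_at_filter)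
    from continuous_map_limit[OF c this] show ?thesis by (simp add: comp_def)
  qed
  have "limitin Y x (x t) (at_right t)" if "t \<in> {0..<1}" for t
  proof -
    have "at t within {t..1} = at_right t" using that by (intro at_within_Icc_at_right) auto
    moreover have "at t within {t..1} \<le> at t within {0..1}" using that by (intro at_le) auto
    ultimately show ?thesis using *[of t] that
      by (auto simp: limitin_def intro: filter_leD)
  qed
  moreover have "limitin Y x (x t) (at_left t)" if "t \<in> {0<..1}" for t
  proof -
    have "at t within {0..t} = at_left t" using that by (intro at_within_Icc_at_left) auto
    moreover have "at t within {0..t} \<le> at t within {0..1}" using that by (intro at_le) auto
    ultimately show ?thesis using *[of t] that
      by (auto simp: limitin_def intro: filter_leD)
  qed
  ultimately show "x \<in> cadlag_paths Y" using e unfolding cadlag_paths_def by blast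
qed


section \<open>Weak convergence of random elements of a topological space\<close>

definition borel_of :: "'b topology \<Rightarrow> 'b measure"
  where "borel_of Y = sigma (topspace Y) {U. openin Y U}"

definition converges_weakly ::
    "'w measure \<Rightarrow> 'b topology \<Rightarrow> (nat \<Rightarrow> 'w \<Rightarrow> 'b) \<Rightarrow> ('w \<Rightarrow> 'b) \<Rightarrow> bool"
  where "converges_weakly M Y \<xi> \<zeta> \<longleftrightarrow>
    (\<forall>n. \<xi> n \<in> M \<rightarrow>\<^sub>M borel_of Y) \<and> \<zeta> \<in> M \<rightarrow>\<^sub>M borel_of Y \<and>
    (\<forall>f. continuous_map Y euclideanreal f \<and> bounded (f ` topspace Y) \<longrightarrow>
       (\<lambda>n. \<integral>\<omega>. f (\<xi> n \<omega>) \<partial>M) \<longlonglongrightarrow> (\<integral>\<omega>. f (\<zeta> \<omega>) \<partial>M))"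


section \<open>Stationary, ergodic and locally stationary processes\<close>

abbreviation path_space :: "(int \<Rightarrow> 'a::topological_space) measure"
  where "path_space \<equiv> Pi\<^sub>M UNIV (\<lambda>_. borel)"

definition stationary :: "'w measure \<Rightarrow> (int \<Rightarrow> 'w \<Rightarrow> 'a::topological_space) \<Rightarrow> bool"
  where "stationary M Y \<longleftrightarrow>
    (\<forall>t. Y t \<in> borel_measurable M) \<and>
    (\<forall>h. distr M path_space (\<lambda>\<omega> t. Y (t + h) \<omega>) = distr M path_space (\<lambda>\<omega> t. Y t \<omega>))"

definition ergodic :: "'w measure \<Rightarrow> (int \<Rightarrow> 'w \<Rightarrow> 'a::topological_space) \<Rightarrow> bool"
  where "ergodic M Y \<longleftrightarrow> stationary M Y \<and>
    (\<forall>A\<in>sets path_space. (\<lambda>x t. x (t + 1)) -` A = A \<longrightarrow>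
       measure M {\<omega> \<in> space M. (\<lambda>t. Y t \<omega>) \<in> A} \<in> {0, 1})"

text \<open>\<open>X t T\<close> is the triangular array, relevant for \<open>T \<ge> 1\<close> only, and \<open>Z t u\<close> is the auxiliary
  process, relevant for \<open>u\<close> in the unit interval only.\<close>

definition locally_stationary ::
    "'w measure \<Rightarrow> (int \<Rightarrow> nat \<Rightarrow> 'w \<Rightarrow> 'a::polish_space) \<Rightarrow> (int \<Rightarrow> real \<Rightarrow> 'w \<Rightarrow> 'a) \<Rightarrow> bool"
  where "locally_stationary M X Z \<longleftrightarrow>
    (\<forall>T\<ge>1. \<forall>t. X t T \<in> borel_measurable M) \<and>
    (\<forall>T\<ge>1. \<forall>\<omega>\<in>space M. (\<forall>t\<le>0. X t T \<omega> = X 1 T \<omega>) \<and> (\<forall>t\<ge>int T. X t T \<omega> = X (int T) T \<omega>)) \<and>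
    (\<forall>u\<in>{0..1}. stationary M (\<lambda>t. Z t u)) \<and>
    (\<exists>C. \<forall>T\<ge>1. \<forall>t\<in>{1..int T}.
       (\<integral>\<omega>. min (dist (X t T \<omega>) (Z t (real_of_int t / real T) \<omega>)) 1 \<partial>M) \<le> C / real T) \<and>
    (\<exists>C. \<forall>T\<ge>1. \<forall>t\<in>{1..int T}. \<forall>u\<in>{0..1}. \<forall>v\<in>{0..1}.
       (\<integral>\<omega>. min (dist (Z t u \<omega>) (Z t v \<omega>)) 1 \<partial>M) \<le> C * \<bar>u - v\<bar>)"


section \<open>The sequential empirical measure and its limit\<close>

definition empirical_measure :: "(int \<Rightarrow> nat \<Rightarrow> 'w \<Rightarrow> 'a::topological_space) \<Rightarrow> nat \<Rightarrow> real \<Rightarrow> 'w \<Rightarrow> 'a measure"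
  where "empirical_measure X T u \<omega> =
    measure_of UNIV (sets borel)
      (\<lambda>A. ennreal (1 / real T) * (\<Sum>t\<in>{1..\<lfloor>u * real T\<rfloor>}. emeasure (return borel (X t T \<omega>)) A))"

definition limit_measure :: "'w measure \<Rightarrow> (int \<Rightarrow> real \<Rightarrow> 'w \<Rightarrow> 'a::topological_space) \<Rightarrow> real \<Rightarrow> 'a measure"
  where "limit_measure M Z u =
    measure_of UNIV (sets borel)
      (\<lambda>A. \<integral>\<^sup>+\<eta>\<in>{0..u}. emeasure M {\<omega> \<in> space M. Z 0 \<eta> \<omega> \<in> A} \<partial>lborel)"

abbreviation empirical_path :: "(int \<Rightarrow> nat \<Rightarrow> 'w \<Rightarrow> 'a::topological_space) \<Rightarrow> nat \<Rightarrow> 'w \<Rightarrow> real \<Rightarrow> 'a measure"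
  where "empirical_path X T \<omega> \<equiv> (\<lambda>u\<in>{0..1}. empirical_measure X T u \<omega>)"

abbreviation limit_path :: "'w measure \<Rightarrow> (int \<Rightarrow> real \<Rightarrow> 'w \<Rightarrow> 'a::topological_space) \<Rightarrow> real \<Rightarrow> 'a measure"
  where "limit_path M Z \<equiv> (\<lambda>u\<in>{0..1}. limit_measure M Z u)"

text \<open>The set functions above are countably additive, so the measures take these values.\<close>

lemma emeasure_empirical_measure:
  fixes X :: "int \<Rightarrow> nat \<Rightarrow> 'w \<Rightarrow> 'a::topological_space"
  assumes A: "A \<in> sets borel"
  shows "emeasure (empirical_measure X T u \<omega>) A =
    ennreal (1 / real T) * (\<Sum>t\<in>{1..\<lfloor>u * real T\<rfloor>}. indicator A (X t T \<omega>))"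
proof -
  let ?\<mu> = "\<lambda>A. ennreal (1 / real T) * (\<Sum>t\<in>{1..\<lfloor>u * real T\<rfloor>}. emeasure (return borel (X t T \<omega>)) A)"
  have "countably_additive (sets (borel :: 'a measure)) ?\<mu>"
  proof (rule countably_additiveI)
    fix B :: "nat \<Rightarrow> 'a set" assume B: "range B \<subseteq> sets borel" "disjoint_family B"
    have "(\<Sum>i. ?\<mu> (B i)) = ennreal (1 / real T) * (\<Sum>i. \<Sum>t\<in>{1..\<lfloor>u * real T\<rfloor>}. emeasure (return borel (X t T \<omega>)) (B i))"
      by (rule ennreal_suminf_cmult)
    also have "(\<Sum>i. \<Sum>t\<in>{1..\<lfloor>u * real T\<rfloor>}. emeasure (return borel (X t T \<omega>)) (B i)) =
        (\<Sum>t\<in>{1..\<lfloor>u * real T\<rfloor>}. \<Sum>i. emeasure (return borel (X t T \<omega>)) (B i))"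
      by (rule suminf_sum) auto
    also have "\<dots> = (\<Sum>t\<in>{1..\<lfloor>u * real T\<rfloor>}. emeasure (return borel (X t T \<omega>)) (\<Union>i. B i))"
      using B by (intro sum.cong refl suminf_emeasure) auto
    finally show "(\<Sum>i. ?\<mu> (B i)) = ?\<mu> (\<Union>i. B i)" .
  qed
  moreover have "positive (sets borel) ?\<mu>" by (simp add: positive_def)
  ultimately have "emeasure (empirical_measure X T u \<omega>) A = ?\<mu> A"
    unfolding empirical_measure_def using A sets.sigma_algebra_axioms[of "borel :: 'a measure"]
    by (intro emeasure_measure_of_sigma) auto
  then show ?thesis using A by simp
qed

lemma measurable_aux_law:
  fixes Z :: "int \<Rightarrow> real \<Rightarrow> 'w \<Rightarrow> 'a::polish_space"
  assumes "prob_space M" "locally_stationary M X Z" "A \<in> sets borel"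
  shows "(\<lambda>\<eta>. emeasure M {\<omega> \<in> space M. Z 0 \<eta> \<omega> \<in> A}) \<in> borel_measurable (restrict_space borel {0..1})"
proof -
  interpret prob_space M by fact
  let ?R = "restrict_space borel {0..1} :: real measure"
  let ?K = "\<lambda>t \<eta>. distr M borel (Z t \<eta>)"
  have st: "stationary M (\<lambda>t. Z t \<eta>)" if "\<eta> \<in> {0..1}" for \<eta>
    using assms(2) that by (auto simp: locally_stationary_def)
  then have Zm: "Z t \<eta> \<in> borel_measurable M" if "\<eta> \<in> {0..1}" for t \<eta>
    using that by (auto simp: stationary_def)
  have law: "?K 0 \<eta> = ?K 1 \<eta>" if \<eta>: "\<eta> \<in> {0..1}" for \<eta>
  proof -
    have m: "(\<lambda>\<omega> t. Z (t + h) \<eta> \<omega>) \<in> M \<rightarrow>\<^sub>M path_space" for h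
      using measurable_PiM_single'[of UNIV "\<lambda>t. Z (t + h) \<eta>" M "\<lambda>_. borel"] Zm[OF \<eta>] by simp
    have "?K h \<eta> = distr (distr M path_space (\<lambda>\<omega> t. Z (t + h) \<eta> \<omega>)) borel (\<lambda>x. x 0)" for h
      by (subst distr_distr[OF _ m]) (auto simp: comp_def)
    note marg = this
    have "distr M path_space (\<lambda>\<omega> t. Z (t + 1) \<eta> \<omega>) = distr M path_space (\<lambda>\<omega> t. Z (t + 0) \<eta> \<omega>)"
      using st[OF \<eta>] by (simp add: stationary_def)
    then show ?thesis unfolding marg by simp
  qed
  obtain C where C: "\<And>u v. u \<in> {0..1} \<Longrightarrow> v \<in> {0..1} \<Longrightarrow>
      (\<integral>\<omega>. min (dist (Z 1 u \<omega>) (Z 1 v \<omega>)) 1 \<partial>M) \<le> C * \<bar>u - v\<bar>"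
  proof -
    obtain C where "\<forall>T\<ge>1. \<forall>t\<in>{1..int T}. \<forall>u\<in>{0..1}. \<forall>v\<in>{0..1}.
       (\<integral>\<omega>. min (dist (Z t u \<omega>) (Z t v \<omega>)) 1 \<partial>M) \<le> C * \<bar>u - v\<bar>"
      using assms(2) unfolding locally_stationary_def by blast
    then have "\<forall>t\<in>{1..int 1}. \<forall>u\<in>{0..1}. \<forall>v\<in>{0..1}.
       (\<integral>\<omega>. min (dist (Z t u \<omega>) (Z t v \<omega>)) 1 \<partial>M) \<le> C * \<bar>u - v\<bar>"
      by (meson order_refl)
    then show ?thesis using that[of C] by auto
  qed
  have cont: "continuous_on {0..1} (\<lambda>\<eta>. \<integral>\<omega>. closed_approx F n (Z 1 \<eta> \<omega>) \<partial>M)" for F and n :: nat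
  proof -
    have int: "integrable M (\<lambda>\<omega>. closed_approx F n (Z 1 u \<omega>))" if "u \<in> {0..1}" for u
      by (intro integrable_const_bound[of _ 1] AE_I2
          measurable_compose[OF Zm[OF that] closed_approx_borel])
        (simp add: closed_approx_bounds)
    have "\<bar>(\<integral>\<omega>. closed_approx F n (Z 1 u \<omega>) \<partial>M) - (\<integral>\<omega>. closed_approx F n (Z 1 v \<omega>) \<partial>M)\<bar>
        \<le> (real n + 1) * max 0 C * \<bar>u - v\<bar>" if u: "u \<in> {0..1}" and v: "v \<in> {0..1}" for u v
    proof -
      have i2: "integrable M (\<lambda>\<omega>. min (dist (Z 1 u \<omega>) (Z 1 v \<omega>)) 1)"
        using Zm[OF u] Zm[OF v] by (intro integrable_const_bound[of _ 1]) auto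
      have "\<bar>(\<integral>\<omega>. closed_approx F n (Z 1 u \<omega>) \<partial>M) - (\<integral>\<omega>. closed_approx F n (Z 1 v \<omega>) \<partial>M)\<bar>
          = \<bar>\<integral>\<omega>. closed_approx F n (Z 1 u \<omega>) - closed_approx F n (Z 1 v \<omega>) \<partial>M\<bar>"
        using int u v by simp
      also have "\<dots> \<le> (\<integral>\<omega>. \<bar>closed_approx F n (Z 1 u \<omega>) - closed_approx F n (Z 1 v \<omega>)\<bar> \<partial>M)"
        by (rule integral_abs_bound)
      also have "\<dots> \<le> (\<integral>\<omega>. (real n + 1) * min (dist (Z 1 u \<omega>) (Z 1 v \<omega>)) 1 \<partial>M)"
      proof (rule integral_mono)
        fix \<omega>
        let ?x = "Z 1 u \<omega>" and ?y = "Z 1 v \<omega>"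
        have "\<bar>closed_approx F n ?x - closed_approx F n ?y\<bar> \<le> (real n + 1) * dist ?x ?y"
          using closed_approx_lipschitz[of F n ?x ?y] by (simp add: distrib_right add.commute add_increasing)
        moreover have "\<bar>closed_approx F n ?x - closed_approx F n ?y\<bar> \<le> 1"
          using closed_approx_bounds[of F n ?x] closed_approx_bounds[of F n ?y] by linarith
        ultimately show "\<bar>closed_approx F n ?x - closed_approx F n ?y\<bar> \<le> (real n + 1) * min (dist ?x ?y) 1"
          by (auto simp: min_def)
      qed (use int u v i2 in auto)
      also have "\<dots> = (real n + 1) * (\<integral>\<omega>. min (dist (Z 1 u \<omega>) (Z 1 v \<omega>)) 1 \<partial>M)"
        by simp
      also have "\<dots> \<le> (real n + 1) * (max 0 C * \<bar>u - v\<bar>)"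
      proof (rule mult_left_mono)
        have "C * \<bar>u - v\<bar> \<le> max 0 C * \<bar>u - v\<bar>" by (rule mult_right_mono) auto
        with C[OF u v] show "(\<integral>\<omega>. min (dist (Z 1 u \<omega>) (Z 1 v \<omega>)) 1 \<partial>M) \<le> max 0 C * \<bar>u - v\<bar>"
          by (rule order_trans)
      qed simp
      finally show ?thesis by (simp add: mult.assoc)
    qed
    then have "((real n + 1) * max 0 C)-lipschitz_on {0..1} (\<lambda>\<eta>. \<integral>\<omega>. closed_approx F n (Z 1 \<eta> \<omega>) \<partial>M)"
      by (intro lipschitz_onI) (auto simp: dist_real_def)
    then show ?thesis by (rule lipschitz_on_continuous_on)
  qed
  have prob: "prob_space (?K 1 \<eta>)" if "\<eta> \<in> {0..1}" for \<eta>
    using Zm[OF that] by (rule prob_space_distr)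
  have spR: "space ?R = {0..1}" by (simp add: space_restrict_space)
  have closed: "(\<lambda>\<eta>. emeasure (?K 1 \<eta>) F) \<in> borel_measurable ?R" if F: "closed F" for F
  proof (cases "F = {}")
    case False
    have "(\<lambda>\<eta>. measure (?K 1 \<eta>) F) \<in> borel_measurable ?R"
    proof (rule borel_measurable_LIMSEQ_real)
      fix \<eta> assume "\<eta> \<in> space ?R"
      then have \<eta>: "\<eta> \<in> {0..1}" by (simp only: spR)
      interpret K: prob_space "?K 1 \<eta>" using prob[OF \<eta>] .
      have "(\<lambda>n. \<integral>x. closed_approx F n x \<partial>?K 1 \<eta>) \<longlonglongrightarrow> measure (?K 1 \<eta>) F"
        by (rule closed_approx_integral_LIMSEQ[OF K.finite_measure_axioms _ F False]) simp
      then show "(\<lambda>n. \<integral>\<omega>. closed_approx F n (Z 1 \<eta> \<omega>) \<partial>M) \<longlonglongrightarrow> measure (?K 1 \<eta>) F"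
        using Zm[OF \<eta>] by (simp add: integral_distr)
    next
      show "(\<lambda>\<eta>. \<integral>\<omega>. closed_approx F n (Z 1 \<eta> \<omega>) \<partial>M) \<in> borel_measurable ?R" for n
        using cont by (rule borel_measurable_continuous_on_restrict)
    qed
    then have "(\<lambda>\<eta>. ennreal (measure (?K 1 \<eta>) F)) \<in> borel_measurable ?R" by simp
    also have "?this \<longleftrightarrow> ?thesis"
    proof (rule measurable_cong)
      fix \<eta> assume "\<eta> \<in> space ?R"
      then have \<eta>: "\<eta> \<in> {0..1}" by (simp only: spR)
      interpret K: prob_space "?K 1 \<eta>" using prob[OF \<eta>] .
      show "ennreal (measure (?K 1 \<eta>) F) = emeasure (?K 1 \<eta>) F" by (simp add: K.emeasure_eq_measure)
    qed
    finally show ?thesis .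
  qed simp
  have "?K 1 \<in> ?R \<rightarrow>\<^sub>M prob_algebra borel"
  proof (rule measurable_prob_algebra_generated[where \<Omega>=UNIV and G="Collect closed"])
    show "sets (borel :: 'a measure) = sigma_sets UNIV (Collect closed)" by (simp add: borel_eq_closed)
    show "Int_stable (Collect closed :: 'a set set)" by (auto simp: Int_stable_def)
  qed (use prob closed spR in auto)
  then have "(\<lambda>\<eta>. emeasure (?K 1 \<eta>) A) \<in> borel_measurable ?R"
    by (rule measurable_emeasure_kernel[OF measurable_prob_algebraD assms(3)])
  also have "?this \<longleftrightarrow> ?thesis"
  proof (rule measurable_cong)
    fix \<eta> assume "\<eta> \<in> space ?R"
    then have \<eta>: "\<eta> \<in> {0..1}" by (simp only: spR)
    show "emeasure (?K 1 \<eta>) A = emeasure M {\<omega> \<in> space M. Z 0 \<eta> \<omega> \<in> A}"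
      unfolding law[OF \<eta>, symmetric] using Zm[OF \<eta>, of 0] assms(3)
      by (simp add: emeasure_distr vimage_def Int_def conj_commute)
  qed
  finally show ?thesis .
qed

lemma emeasure_limit_measure:
  fixes Z :: "int \<Rightarrow> real \<Rightarrow> 'w \<Rightarrow> 'a::polish_space"
  assumes "prob_space M" "locally_stationary M X Z" "u \<in> {0..1}" "A \<in> sets borel"
  shows "emeasure (limit_measure M Z u) A =
    (\<integral>\<^sup>+\<eta>\<in>{0..u}. emeasure M {\<omega> \<in> space M. Z 0 \<eta> \<omega> \<in> A} \<partial>lborel)"
proof -
  interpret prob_space M by fact
  let ?P = "\<lambda>A \<eta>. emeasure M {\<omega> \<in> space M. Z 0 \<eta> \<omega> \<in> A}"
  let ?\<mu> = "\<lambda>A. \<integral>\<^sup>+\<eta>\<in>{0..u}. ?P A \<eta> \<partial>lborel"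
  have Zm: "Z t \<eta> \<in> borel_measurable M" if "\<eta> \<in> {0..1}" for t \<eta>
    using assms(2) that by (auto simp: locally_stationary_def stationary_def)
  have meas: "(\<lambda>\<eta>. ?P B \<eta> * indicator {0..u} \<eta>) \<in> borel_measurable lborel" if "B \<in> sets borel" for B
  proof -
    have "(\<lambda>\<eta>. ?P B \<eta> * indicator {0..1} \<eta>) \<in> borel_measurable borel"
      using measurable_aux_law[OF assms(1,2) that]
      by (subst (asm) borel_measurable_restrict_space_iff_ennreal) auto
    then have "(\<lambda>\<eta>. ?P B \<eta> * indicator {0..1} \<eta> * indicator {0..u} \<eta>) \<in> borel_measurable borel"
      by measurable
    also have "(\<lambda>\<eta>. ?P B \<eta> * indicator {0..1} \<eta> * indicator {0..u} \<eta>) = (\<lambda>\<eta>. ?P B \<eta> * indicator {0..u} \<eta>)"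
      using assms(3) by (auto simp: indicator_def fun_eq_iff)
    finally show ?thesis by simp
  qed
  have "countably_additive (sets (borel :: 'a measure)) ?\<mu>"
  proof (rule countably_additiveI)
    fix B :: "nat \<Rightarrow> 'a set" assume B: "range B \<subseteq> sets borel" "disjoint_family B"
    have "(\<Sum>i. ?\<mu> (B i)) = (\<integral>\<^sup>+\<eta>. (\<Sum>i. ?P (B i) \<eta> * indicator {0..u} \<eta>) \<partial>lborel)"
      using B meas by (intro nn_integral_suminf[symmetric]) auto
    also have "\<dots> = ?\<mu> (\<Union>i. B i)"
    proof (rule nn_integral_cong)
      fix \<eta> :: real
      show "(\<Sum>i. ?P (B i) \<eta> * indicator {0..u} \<eta>) = ?P (\<Union>i. B i) \<eta> * indicator {0..u} \<eta>"
      proof (cases "\<eta> \<in> {0..u}")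
        case True
        then have [measurable]: "Z 0 \<eta> \<in> borel_measurable M" using Zm assms(3) by auto
        have "(\<Sum>i. ?P (B i) \<eta>) = emeasure M (\<Union>i. {\<omega> \<in> space M. Z 0 \<eta> \<omega> \<in> B i})"
        proof (rule suminf_emeasure)
          have "{\<omega> \<in> space M. Z 0 \<eta> \<omega> \<in> B i} \<in> sets M" for i
          proof -
            have [measurable]: "B i \<in> sets borel" using B by auto
            show ?thesis by measurable
          qed
          then show "range (\<lambda>i. {\<omega> \<in> space M. Z 0 \<eta> \<omega> \<in> B i}) \<subseteq> sets M" by auto
          show "disjoint_family (\<lambda>i. {\<omega> \<in> space M. Z 0 \<eta> \<omega> \<in> B i})"
            using B(2) by (auto simp: disjoint_family_on_def)
        qed
        also have "(\<Union>i. {\<omega> \<in> space M. Z 0 \<eta> \<omega> \<in> B i}) = {\<omega> \<in> space M. Z 0 \<eta> \<omega> \<in> (\<Union>i. B i)}" by auto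
        finally show ?thesis using True by simp
      qed simp
    qed
    finally show "(\<Sum>i. ?\<mu> (B i)) = ?\<mu> (\<Union>i. B i)" .
  qed
  moreover have "positive (sets borel) ?\<mu>" by (simp add: positive_def)
  ultimately show ?thesis
    unfolding limit_measure_def using assms(4) sets.sigma_algebra_axioms[of "borel :: 'a measure"]
    by (intro emeasure_measure_of_sigma) auto
qed

end

theory Submission
  imports Defs
begin

text \<open>The limit path is deterministic, so weak convergence amounts to convergence in probability of
  the Skorokhod distance (\<open>converges_weakly_to_constant\<close>).  The identity is a time change, so this
  distance is at most the supremum over \<open>u\<close> of the bounded Lipschitz distance between
  \<open>\<mu>\<^sub>T\<^sub>,\<^sub>u\<close> and the limit at \<open>u\<close>.  The heart of the proof is \<open>uniform_bound_in_mean\<close>: this supremum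
  lies below an integrable random variable whose mean is at most \<open>\<delta> + K / T\<close>, with \<open>\<delta>\<close> arbitrarily
  small; Markov's inequality then concludes.  Bounding by a measurable majorant avoids the
  measurability of suprema over uncountably many test functions and times.

  For the bound, cut the unit interval into \<open>N\<close> cells.  On the block of times \<open>t\<close> for which \<open>t / T\<close>
  lies in the cell with right end point \<open>v\<close>, local stationarity lets \<open>Z\<^sub>t(v)\<close> replace \<open>X\<^sub>t\<^sub>,\<^sub>T\<close> at a
  mean cost of order \<open>1 / T + 1 / N\<close>, and \<open>Z\<^sub>t(v)\<close> is a fixed stationary ergodic sequence.  Its
  empirical measure obeys a law of large numbers that is uniform over the bounded Lipschitz unit
  ball (\<open>ergodic_bl_law_of_large_numbers\<close>).  The law of \<open>Z\<^sub>1(\<eta>)\<close> is Lipschitz in \<open>\<eta>\<close>, so the sum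
  over the blocks is a Riemann sum for the limit measure.  Both paths change by at most about
  \<open>1 / N\<close> within a cell, which turns the bound on the grid into a bound for all \<open>u\<close>.

  Uniformity over test functions costs nothing but separability: a map \<open>q\<close> with finite range that is
  close to the identity in mean reduces all test functions at once to the frequencies of the
  finitely many level sets of \<open>q\<close>.  These frequencies converge by Birkhoff's ergodic theorem,
  proved first, in the ergodic case, by the maximal function argument of Garsia.\<close>

section \<open>The pointwise ergodic theorem for ergodic transformations\<close>

text \<open>The maximum of the Birkhoff sums \<open>S\<^sub>0, \<dots>, S\<^sub>n\<close> of \<open>f\<close>, where \<open>S\<^sub>0 = 0\<close>.  The recursion is the
  cocycle identity \<open>S\<^sub>k\<^sub>+\<^sub>1 x = f x + S\<^sub>k (\<theta> x)\<close>.\<close>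

primrec max_birkhoff :: "('b \<Rightarrow> 'b) \<Rightarrow> ('b \<Rightarrow> real) \<Rightarrow> nat \<Rightarrow> 'b \<Rightarrow> real"
  where "max_birkhoff \<theta> f 0 x = 0"
  | "max_birkhoff \<theta> f (Suc n) x = max 0 (f x + max_birkhoff \<theta> f n (\<theta> x))"

lemma max_birkhoff_nonneg: "0 \<le> max_birkhoff \<theta> f n x"
  by (cases n) auto

lemma incseq_max_birkhoff: "incseq (\<lambda>n. max_birkhoff \<theta> f n x)"
proof (rule incseq_SucI)
  show "max_birkhoff \<theta> f n x \<le> max_birkhoff \<theta> f (Suc n) x" for n
  proof (induction n arbitrary: x)
    case (Suc n)
    show ?case using Suc.IH[of "\<theta> x"] by (simp only: max_birkhoff.simps)
  qed simp
qed

lemma birkhoff_sum_le_max_birkhoff: "(\<Sum>k<n. f ((\<theta> ^^ k) x)) \<le> max_birkhoff \<theta> f n x"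
proof (induction n arbitrary: x)
  case (Suc n)
  have "(\<Sum>k<Suc n. f ((\<theta> ^^ k) x)) = f x + (\<Sum>k<n. f ((\<theta> ^^ k) (\<theta> x)))"
    by (simp add: sum.lessThan_Suc_shift funpow_swap1 del: sum.lessThan_Suc)
  then show ?case using Suc.IH[of "\<theta> x"] by simp
qed simp

locale ergodic_transformation = prob_space Q for Q :: "'b measure" +
  fixes \<theta> :: "'b \<Rightarrow> 'b"
  assumes measurable_shift [measurable]: "\<theta> \<in> Q \<rightarrow>\<^sub>M Q"
    and distr_shift: "distr Q Q \<theta> = Q"
    and invariant_trivial: "A \<in> sets Q \<Longrightarrow> \<theta> -` A \<inter> space Q = A \<Longrightarrow> prob A = 0 \<or> prob A = 1"
begin

lemma shift_space: "x \<in> space Q \<Longrightarrow> \<theta> x \<in> space Q"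
  using measurable_shift by (rule measurable_space)

lemma integrable_shift: "integrable Q (g :: 'b \<Rightarrow> real) \<Longrightarrow> integrable Q (\<lambda>x. g (\<theta> x))"
  by (rule integrable_distr[OF measurable_shift]) (simp add: distr_shift)

lemma integral_shift:
  assumes "integrable Q (g :: 'b \<Rightarrow> real)"
  shows "(\<integral>x. g (\<theta> x) \<partial>Q) = (\<integral>x. g x \<partial>Q)"
  using integral_distr[OF measurable_shift, of g] assms by (simp add: distr_shift)

lemma integrable_max_birkhoff:
  assumes f: "integrable Q f"
  shows "integrable Q (max_birkhoff \<theta> f n)"
proof (induction n)
  case (Suc n)
  have "integrable Q (\<lambda>x. max 0 (f x + max_birkhoff \<theta> f n (\<theta> x)))"
    using f integrable_shift[OF Suc.IH] by auto
  then show ?case by (simp add: fun_eq_iff[symmetric] cong: integrable_cong)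
qed (simp add: fun_eq_iff)

text \<open>The set \<open>A\<close> on which the maxima \<open>G\<^sub>n\<close> are unbounded is strictly invariant, hence trivial.
  If it had full measure, then \<open>G\<^sub>n\<^sub>+\<^sub>1 - G\<^sub>n \<circ> \<theta> = max f (- G\<^sub>n \<circ> \<theta>)\<close> would decrease to \<open>f\<close> almost
  everywhere; but its integral is that of \<open>G\<^sub>n\<^sub>+\<^sub>1 - G\<^sub>n\<close>, which is nonnegative, so \<open>f\<close> could not have
  a negative mean.\<close>

lemma birkhoff_sums_bounded_above:
  fixes f :: "'b \<Rightarrow> real"
  assumes f: "integrable Q f" and neg: "(\<integral>x. f x \<partial>Q) < 0"
  shows "AE x in Q. \<exists>K. \<forall>n. (\<Sum>k<n. f ((\<theta> ^^ k) x)) \<le> K"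
proof -
  let ?G = "max_birkhoff \<theta> f"
  define A where "A = {x \<in> space Q. \<forall>K::nat. \<exists>n. real K < ?G n x}"
  note int = integrable_max_birkhoff[OF f]
  note [measurable] = borel_measurable_integrable[OF f] borel_measurable_integrable[OF int]
  have A: "A \<in> sets Q" unfolding A_def by measurable
  have "(\<forall>K::nat. \<exists>n. real K < ?G n (\<theta> x)) \<longleftrightarrow> (\<forall>K::nat. \<exists>n. real K < ?G n x)" for x
  proof (intro iffI allI)
    fix K :: nat
    assume *: "\<forall>K::nat. \<exists>n. real K < ?G n (\<theta> x)"
    obtain L :: nat where L: "real K - f x \<le> real L" using real_arch_simple by blast
    obtain n where "real L < ?G n (\<theta> x)" using * by blast
    then have "real K < ?G (Suc n) x" using L by simp
    then show "\<exists>n. real K < ?G n x" by blast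
  next
    fix K :: nat
    assume *: "\<forall>K::nat. \<exists>n. real K < ?G n x"
    obtain L :: nat where L: "real K + \<bar>f x\<bar> \<le> real L" using real_arch_simple by blast
    obtain n where n: "real L < ?G n x" using * by blast
    obtain m where "n = Suc m" using n by (cases n) auto
    then have "real K < ?G m (\<theta> x)" using n L by (auto simp: max_def split: if_splits)
    then show "\<exists>n. real K < ?G n (\<theta> x)" by blast
  qed
  then have inv: "\<theta> -` A \<inter> space Q = A"
    using shift_space by (auto simp: A_def)
  have "prob A \<noteq> 1"
  proof
    assume "prob A = 1"
    then have AE_A: "AE x in Q. x \<in> A" using A by (simp add: prob_eq_1)
    let ?h = "\<lambda>n x. max (f x) (- ?G n (\<theta> x))"
    have "(\<lambda>n. \<integral>x. ?h n x \<partial>Q) \<longlonglongrightarrow> (\<integral>x. f x \<partial>Q)"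
    proof (rule integral_dominated_convergence[where w="\<lambda>x. \<bar>f x\<bar>"])
      show "AE x in Q. (\<lambda>n. ?h n x) \<longlonglongrightarrow> f x"
        using AE_A
      proof eventually_elim
        fix x assume "x \<in> A"
        then have "\<theta> x \<in> A" using inv by blast
        obtain L :: nat where L: "- f x \<le> real L" using real_arch_simple by blast
        obtain N where N: "real L < ?G N (\<theta> x)" using \<open>\<theta> x \<in> A\<close> by (auto simp: A_def)
        have "?h n x = f x" if "n \<ge> N" for n
          using incseqD[OF incseq_max_birkhoff[of \<theta> f "\<theta> x"] that] N L by auto
        then show "(\<lambda>n. ?h n x) \<longlonglongrightarrow> f x"
          by (intro tendsto_eventually) (auto simp: eventually_sequentially)
      qed
      show "AE x in Q. norm (?h n x) \<le> \<bar>f x\<bar>" for n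
        using max_birkhoff_nonneg[of \<theta> f n "\<theta> _"] by (intro AE_I2) (smt (verit) max_birkhoff_nonneg real_norm_def)
    qed (use f in auto)
    moreover have "0 \<le> (\<integral>x. ?h n x \<partial>Q)" for n
    proof -
      have h: "?h n x = ?G (Suc n) x - ?G n (\<theta> x)" for x by (auto simp: max_def)
      have "(\<integral>x. ?h n x \<partial>Q) = (\<integral>x. ?G (Suc n) x \<partial>Q) - (\<integral>x. ?G n x \<partial>Q)"
        unfolding h using int integrable_shift[OF int]
        by (subst Bochner_Integration.integral_diff) (auto simp: integral_shift[OF int] simp del: max_birkhoff.simps)
      moreover have "(\<integral>x. ?G n x \<partial>Q) \<le> (\<integral>x. ?G (Suc n) x \<partial>Q)"
        using incseq_SucD[OF incseq_max_birkhoff] by (intro integral_mono int)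
      ultimately show ?thesis by simp
    qed
    ultimately have "0 \<le> (\<integral>x. f x \<partial>Q)" by (blast intro: LIMSEQ_le_const)
    then show False using neg by simp
  qed
  then have "prob A = 0" using invariant_trivial[OF A inv] by simp
  then have "AE x in Q. x \<notin> A" using A by (simp add: prob_eq_0)
  then show ?thesis
    using AE_space
  proof eventually_elim
    fix x assume "x \<notin> A" "x \<in> space Q"
    then obtain K :: nat where K: "\<And>n. ?G n x \<le> real K" unfolding A_def by (auto simp: not_less)
    show "\<exists>K. \<forall>n. (\<Sum>k<n. f ((\<theta> ^^ k) x)) \<le> K"
      using order_trans[OF birkhoff_sum_le_max_birkhoff K] by blast
  qed
qed

text \<open>Subtracting slightly more than the mean from \<open>g\<close> leaves a function of negative mean, whose
  sums are bounded above; dividing by \<open>n\<close> removes the bound.\<close>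

lemma birkhoff_averages_eventually_less:
  fixes g :: "'b \<Rightarrow> real"
  assumes g: "integrable Q g" and e: "0 < e"
  shows "AE x in Q. \<forall>\<^sub>F n in sequentially. (\<Sum>k<n. g ((\<theta> ^^ k) x)) / n < (\<integral>x. g x \<partial>Q) + e"
proof -
  let ?c = "(\<integral>x. g x \<partial>Q) + e / 2"
  have "AE x in Q. \<exists>K. \<forall>n. (\<Sum>k<n. g ((\<theta> ^^ k) x) - ?c) \<le> K"
    by (rule birkhoff_sums_bounded_above[of "\<lambda>x. g x - ?c"]) (use g e in \<open>auto simp: prob_space\<close>)
  then show ?thesis
  proof eventually_elim
    fix x assume "\<exists>K. \<forall>n. (\<Sum>k<n. g ((\<theta> ^^ k) x) - ?c) \<le> K"
    then obtain K where K: "\<And>n. (\<Sum>k<n. g ((\<theta> ^^ k) x)) - n * ?c \<le> K"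
      by (auto simp: sum_subtractf)
    obtain N :: nat where N: "2 * K / e < real N" using reals_Archimedean2 by blast
    have "(\<Sum>k<n. g ((\<theta> ^^ k) x)) / n < (\<integral>x. g x \<partial>Q) + e" if n: "n \<ge> max 1 N" for n
    proof -
      have "2 * K / e < real n" using N n by linarith
      then have "K < n * (e / 2)" using e by (simp add: field_simps)
      then have "(\<Sum>k<n. g ((\<theta> ^^ k) x)) < n * ?c + n * (e / 2)" using K[of n] by linarith
      also have "\<dots> = n * ((\<integral>x. g x \<partial>Q) + e)" by (simp add: algebra_simps)
      finally show ?thesis using n by (simp add: divide_less_eq mult.commute)
    qed
    then show "\<forall>\<^sub>F n in sequentially. (\<Sum>k<n. g ((\<theta> ^^ k) x)) / n < (\<integral>x. g x \<partial>Q) + e"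
      unfolding eventually_sequentially by blast
  qed
qed

text \<open>The upper bound, applied to \<open>g\<close> and to \<open>- g\<close> along the null sequence \<open>1 / (i + 1)\<close>.\<close>

theorem birkhoff_pointwise:
  fixes g :: "'b \<Rightarrow> real"
  assumes g: "integrable Q g"
  shows "AE x in Q. (\<lambda>n. (\<Sum>k<n. g ((\<theta> ^^ k) x)) / n) \<longlonglongrightarrow> (\<integral>x. g x \<partial>Q)"
proof -
  let ?S = "\<lambda>x n. (\<Sum>k<n. g ((\<theta> ^^ k) x)) / real n" and ?m = "\<integral>x. g x \<partial>Q"
  have "AE x in Q. \<forall>i::nat. (\<forall>\<^sub>F n in sequentially. ?S x n < ?m + 1 / Suc i) \<and>
      (\<forall>\<^sub>F n in sequentially. - ?S x n < - ?m + 1 / Suc i)"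
    using birkhoff_averages_eventually_less[OF g] birkhoff_averages_eventually_less[of "\<lambda>x. - g x"] g
    by (subst AE_all_countable) (auto simp: sum_negf)
  then show ?thesis
  proof eventually_elim
    fix x
    assume *: "\<forall>i::nat. (\<forall>\<^sub>F n in sequentially. ?S x n < ?m + 1 / Suc i) \<and>
      (\<forall>\<^sub>F n in sequentially. - ?S x n < - ?m + 1 / Suc i)"
    show "?S x \<longlonglongrightarrow> ?m"
    proof (rule tendstoI)
      fix e :: real assume "e > 0"
      then obtain i where i: "1 / real (Suc i) < e" using nat_approx_posE by blast
      have "\<forall>\<^sub>F n in sequentially. ?S x n < ?m + 1 / Suc i \<and> - ?S x n < - ?m + 1 / Suc i"
        using * by (intro eventually_conj) auto
      then show "\<forall>\<^sub>F n in sequentially. dist (?S x n) ?m < e"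
        by eventually_elim (use i in \<open>auto simp: dist_real_def abs_if\<close>)
    qed
  qed
qed

end

section \<open>Stationary ergodic sequences\<close>

lemma stationary_measurable: "stationary M Y \<Longrightarrow> Y t \<in> borel_measurable M"
  by (simp add: stationary_def)

lemma measurable_path:
  assumes "\<And>t. Y t \<in> borel_measurable M"
  shows "(\<lambda>\<omega> t. Y t \<omega>) \<in> M \<rightarrow>\<^sub>M path_space"
  using measurable_PiM_single'[of UNIV Y M "\<lambda>_. borel"] assms by simp

lemma stationary_marginal:
  assumes "stationary M Y"
  shows "distr M borel (Y s) = distr M borel (Y t)"
proof -
  have marg: "distr M borel (Y h) = distr (distr M path_space (\<lambda>\<omega> t. Y (t + h) \<omega>)) borel (\<lambda>x. x 0)" for h
    by (subst distr_distr[OF _ measurable_path])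
      (use assms in \<open>auto simp: comp_def stationary_measurable\<close>)
  show ?thesis unfolding marg using assms by (simp add: stationary_def)
qed

lemma stationary_integral:
  fixes g :: "'a::topological_space \<Rightarrow> real"
  assumes "stationary M Y" "g \<in> borel_measurable borel"
  shows "(\<integral>\<omega>. g (Y s \<omega>) \<partial>M) = (\<integral>\<omega>. g (Y t \<omega>) \<partial>M)"
  using stationary_marginal[OF assms(1), of s t] assms(2) stationary_measurable[OF assms(1)]
  by (metis integral_distr)

text \<open>Passing from the process to its law on path space makes Birkhoff's theorem applicable to
  processes, which need not come from a transformation of the underlying probability space.\<close>

lemma ergodic_transformation_path_shift:
  assumes "prob_space M" "ergodic M Y"
  shows "ergodic_transformation (distr M path_space (\<lambda>\<omega> t. Y t \<omega>)) (\<lambda>x t. x (t + 1))"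
proof -
  interpret prob_space M by fact
  have st: "stationary M Y" using assms(2) by (simp add: ergodic_def)
  note Y = measurable_path[OF stationary_measurable[OF st]]
  let ?Q = "distr M path_space (\<lambda>\<omega> t. Y t \<omega>)" and ?\<theta> = "\<lambda>x t. x (t + 1 :: int)"
  have \<theta>: "?\<theta> \<in> path_space \<rightarrow>\<^sub>M (path_space :: (int \<Rightarrow> 'b) measure)"
    by (rule measurable_path[of "\<lambda>t x. x (t + 1)"]) simp
  interpret Q: prob_space ?Q by (rule prob_space_distr[OF Y])
  show ?thesis
  proof
    show "?\<theta> \<in> ?Q \<rightarrow>\<^sub>M ?Q" using \<theta> by simp
    have "distr ?Q ?Q ?\<theta> = distr ?Q path_space ?\<theta>" by (rule distr_cong) auto
    also have "\<dots> = distr M path_space (\<lambda>\<omega> t. Y (t + 1) \<omega>)"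
      by (subst distr_distr[OF \<theta> Y]) (simp add: comp_def)
    also have "\<dots> = ?Q" using st by (simp add: stationary_def)
    finally show "distr ?Q ?Q ?\<theta> = ?Q" .
    fix A assume A: "A \<in> sets ?Q" and "?\<theta> -` A \<inter> space ?Q = A"
    then have "?\<theta> -` A = A" by (simp add: space_PiM)
    moreover have "Q.prob A = prob {\<omega> \<in> space M. (\<lambda>t. Y t \<omega>) \<in> A}"
      using A by (subst measure_distr[OF Y]) (auto simp: vimage_def Int_def conj_commute)
    ultimately show "Q.prob A = 0 \<or> Q.prob A = 1"
      using assms(2) A by (auto simp: ergodic_def)
  qed
qed

lemma sum_int_atLeastAtMost: "(\<Sum>t\<in>{1..int n}. h t) = (\<Sum>k<n. h (int k + 1))"
proof (induction n)
  case (Suc n)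
  have "{1..int (Suc n)} = insert (int n + 1) {1..int n}" by auto
  then show ?case using Suc by (simp add: add.commute)
qed simp

text \<open>Birkhoff's theorem for the function \<open>x \<mapsto> g (x 1)\<close> on path space gives almost sure convergence;
  boundedness of \<open>g\<close> upgrades it to convergence in mean, which can be summed over blocks.\<close>

lemma ergodic_mean_convergence:
  fixes g :: "'a::topological_space \<Rightarrow> real"
  assumes "prob_space M" "ergodic M Y" and g [measurable]: "g \<in> borel_measurable borel"
    and B: "\<And>x. \<bar>g x\<bar> \<le> B"
  shows "(\<lambda>n. (\<integral>\<omega>. \<bar>(\<Sum>t\<in>{1..int n}. g (Y t \<omega>)) - n * (\<integral>\<omega>. g (Y 1 \<omega>) \<partial>M)\<bar> \<partial>M) / n) \<longlonglongrightarrow> 0"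
proof -
  interpret prob_space M by fact
  have st: "stationary M Y" using assms(2) by (simp add: ergodic_def)
  note Ym [measurable] = stationary_measurable[OF st]
  note Y = measurable_path[of Y M, OF Ym]
  let ?Q = "distr M path_space (\<lambda>\<omega> t. Y t \<omega>)" and ?\<theta> = "\<lambda>x t. x (t + 1 :: int) :: 'a"
  interpret Q: ergodic_transformation ?Q ?\<theta>
    using assms by (intro ergodic_transformation_path_shift)
  let ?m = "\<integral>\<omega>. g (Y 1 \<omega>) \<partial>M"
  have pow: "(?\<theta> ^^ k) x = (\<lambda>t. x (t + int k))" for k x
    by (induction k arbitrary: x) (auto simp: algebra_simps)
  have [measurable]: "(\<lambda>x. g (x 1)) \<in> borel_measurable path_space"
    by (rule measurable_compose[OF _ g]) simp
  have "integrable ?Q (\<lambda>x. g (x 1))"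
    by (rule Q.integrable_const_bound[of _ B]) (use B in auto)
  from Q.birkhoff_pointwise[OF this]
  have "AE x in ?Q. (\<lambda>n. (\<Sum>k<n. g (x (1 + int k))) / n) \<longlonglongrightarrow> ?m"
    by (simp add: pow integral_distr[OF Y])
  from AE_distrD[OF Y this]
  have conv: "AE \<omega> in M. (\<lambda>n. (\<Sum>t\<in>{1..int n}. g (Y t \<omega>)) / n) \<longlonglongrightarrow> ?m"
    by (simp add: sum_int_atLeastAtMost add.commute)
  have "(\<lambda>n. \<integral>\<omega>. \<bar>(\<Sum>t\<in>{1..int n}. g (Y t \<omega>)) / n - ?m\<bar> \<partial>M) \<longlonglongrightarrow> (\<integral>\<omega>. 0 \<partial>M)"
  proof (rule integral_dominated_convergence[where w="\<lambda>_. B + \<bar>?m\<bar>"])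
    show "AE \<omega> in M. (\<lambda>n. \<bar>(\<Sum>t\<in>{1..int n}. g (Y t \<omega>)) / n - ?m\<bar>) \<longlonglongrightarrow> 0"
      using conv by eventually_elim (simp add: tendsto_rabs_zero_iff LIM_zero_iff)
    show "AE \<omega> in M. norm \<bar>(\<Sum>t\<in>{1..int n}. g (Y t \<omega>)) / n - ?m\<bar> \<le> B + \<bar>?m\<bar>" for n
    proof (rule AE_I2)
      fix \<omega>
      have "\<bar>\<Sum>t\<in>{1..int n}. g (Y t \<omega>)\<bar> \<le> (\<Sum>t\<in>{1..int n}. B)"
        by (rule order_trans[OF sum_abs sum_mono]) (rule B)
      then have "\<bar>(\<Sum>t\<in>{1..int n}. g (Y t \<omega>)) / n\<bar> \<le> B"
        using B[of undefined] by (cases "n = 0") (auto simp: field_simps)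
      then show "norm \<bar>(\<Sum>t\<in>{1..int n}. g (Y t \<omega>)) / n - ?m\<bar> \<le> B + \<bar>?m\<bar>"
        unfolding real_norm_def by linarith
    qed
  qed auto
  moreover have "(\<integral>\<omega>. \<bar>(\<Sum>t\<in>{1..int n}. g (Y t \<omega>)) / n - ?m\<bar> \<partial>M)
      = (\<integral>\<omega>. \<bar>(\<Sum>t\<in>{1..int n}. g (Y t \<omega>)) - n * ?m\<bar> \<partial>M) / n" if "n \<ge> 1" for n
  proof -
    have "(\<Sum>t\<in>{1..int n}. g (Y t \<omega>)) / n - ?m = ((\<Sum>t\<in>{1..int n}. g (Y t \<omega>)) - n * ?m) / n" for \<omega>
      using that by (simp add: field_simps)
    then show ?thesis by simp
  qed
  ultimately show ?thesis
    by (auto elim!: Lim_transform_eventually intro!: eventually_sequentiallyI[of 1])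
qed

text \<open>On a separable metric space the identity is a pointwise limit of Borel maps of finite range.
  This takes the place of tightness in the law of large numbers below.\<close>

lemma simple_approximation_in_mean:
  fixes \<nu> :: "'a::{metric_space, second_countable_topology} measure"
  assumes "finite_measure \<nu>" and s [measurable_cong]: "sets \<nu> = sets borel" and e: "0 < e"
  obtains q :: "'a \<Rightarrow> 'a" where "finite (range q)" "q \<in> borel_measurable borel"
    "(\<integral>x. min (dist x (q x)) 1 \<partial>\<nu>) < e"
proof -
  interpret finite_measure \<nu> by fact
  obtain q where q: "\<And>i. simple_function borel (q i)" "\<And>x::'a. (\<lambda>i. q i x) \<longlonglongrightarrow> x"
    using borel_measurable_implies_sequence_metric[of "\<lambda>x::'a. x" borel undefined] by auto
  have [measurable]: "q i \<in> borel_measurable borel" for i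
    using q(1) by (rule borel_measurable_simple_function)
  have "(\<lambda>i. \<integral>x. min (dist x (q i x)) 1 \<partial>\<nu>) \<longlonglongrightarrow> (\<integral>x. 0 \<partial>\<nu>)"
  proof (rule integral_dominated_convergence[where w="\<lambda>_. 1"])
    show "AE x in \<nu>. (\<lambda>i. min (dist x (q i x)) 1) \<longlonglongrightarrow> 0"
    proof (rule AE_I2)
      fix x
      have "(\<lambda>i. min (dist x (q i x)) 1) \<longlonglongrightarrow> min (dist x x) 1"
        by (intro tendsto_intros q(2))
      then show "(\<lambda>i. min (dist x (q i x)) 1) \<longlonglongrightarrow> 0" by simp
    qed
    show "AE x in \<nu>. norm (min (dist x (q i x)) 1) \<le> 1" for i
      by (intro AE_I2) simp
  qed auto
  then have "\<forall>\<^sub>F i in sequentially. (\<integral>x. min (dist x (q i x)) 1 \<partial>\<nu>) < e"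
    using e by (intro order_tendstoD(2)) auto
  then obtain i where "(\<integral>x. min (dist x (q i x)) 1 \<partial>\<nu>) < e"
    using eventually_happens by force
  moreover have "finite (range (q i))" using simple_functionD(1)[OF q(1)[of i]] by simp
  ultimately show ?thesis using that by simp
qed

lemma bl_norm_le_1_min_dist:
  assumes "bl_norm f \<le> 1"
  shows "\<bar>f x - f y\<bar> \<le> 2 * min (dist x y) 1"
  using bl_norm_le_1D(1)[OF assms, of x] bl_norm_le_1D(1)[OF assms, of y]
    bl_norm_le_1D(2)[OF assms, of x y] zero_le_dist[of x y] by (auto simp: min_def)

text \<open>With \<open>q\<close> as above, replacing \<open>f\<close> by \<open>f \<circ> q\<close> costs at most \<open>2 * min (dist x (q x)) 1\<close> at \<open>x\<close>,
  whatever the test function \<open>f\<close>, and \<open>f \<circ> q\<close> is a combination, with coefficients in \<open>[-1, 1]\<close>, of the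
  indicators of the finitely many level sets of \<open>q\<close>.  So one majorant \<open>W n\<close> serves all \<open>f\<close>.  The
  constant \<open>K\<close> absorbs small \<open>n\<close>, so that the bound holds for every \<open>n\<close>, the time \<open>0\<close> where the first block
  begins included.\<close>

lemma ergodic_bl_law_of_large_numbers:
  fixes Y :: "int \<Rightarrow> 'w \<Rightarrow> 'a::polish_space"
  assumes "prob_space M" "ergodic M Y" and e: "0 < e"
  obtains W :: "nat \<Rightarrow> 'w \<Rightarrow> real" and K :: real
  where "\<And>n. integrable M (W n)"
    "\<And>n f \<omega>. bl_norm f \<le> 1 \<Longrightarrow>
      \<bar>(\<Sum>t\<in>{1..int n}. f (Y t \<omega>)) - n * (\<integral>\<omega>. f (Y 1 \<omega>) \<partial>M)\<bar> \<le> W n \<omega>"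
    "\<And>n. (\<integral>\<omega>. W n \<omega> \<partial>M) \<le> e * n + K"
proof -
  interpret prob_space M by fact
  have st: "stationary M Y" using assms(2) by (simp add: ergodic_def)
  note Ym [measurable] = stationary_measurable[OF st]
  interpret D: prob_space "distr M borel (Y 1)" by (rule prob_space_distr[OF Ym])
  obtain q :: "'a \<Rightarrow> 'a" where q: "finite (range q)" "q \<in> borel_measurable borel"
    "(\<integral>x. min (dist x (q x)) 1 \<partial>distr M borel (Y 1)) < e / 8"
    using simple_approximation_in_mean[of "distr M borel (Y 1)" "e / 8"] e D.finite_measure_axioms by auto
  note [measurable] = q(2)
  define g where "g x = min (dist x (q x)) 1" for x
  have [measurable]: "g \<in> borel_measurable borel" unfolding g_def by measurable
  have g: "0 \<le> g x" "g x \<le> 1" for x by (auto simp: g_def)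
  have int: "integrable M (\<lambda>\<omega>. h (Y t \<omega>))"
    if "h \<in> borel_measurable borel" "\<And>x. \<bar>h x\<bar> \<le> 1" for h :: "'a \<Rightarrow> real" and t
    using that by (intro integrable_const_bound[of _ 1]) auto
  have ig: "integrable M (\<lambda>\<omega>. g (Y t \<omega>))" for t using g by (intro int) auto
  define Eg where "Eg = (\<integral>\<omega>. g (Y 1 \<omega>) \<partial>M)"
  have Eg: "Eg < e / 8" using q(3) by (simp add: Eg_def g_def integral_distr)
  have Egt: "(\<integral>\<omega>. g (Y t \<omega>) \<partial>M) = Eg" for t unfolding Eg_def by (rule stationary_integral[OF st]) simp
  define c where "c s x = indicat_real (q -` {s}) x" for s x
  have cm [measurable]: "c s \<in> borel_measurable borel" for s
  proof -
    have "q -` {s} \<in> sets borel" using measurable_sets[OF q(2), of "{s}"] by simp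
    then show ?thesis unfolding c_def by simp
  qed
  have c1: "\<bar>c s x\<bar> \<le> 1" for s x by (simp add: c_def indicator_def)
  have ic: "integrable M (\<lambda>\<omega>. c s (Y t \<omega>))" for s t using c1 by (intro int) auto
  define N where "N s n \<omega> = \<bar>(\<Sum>t\<in>{1..int n}. c s (Y t \<omega>)) - n * (\<integral>\<omega>. c s (Y 1 \<omega>) \<partial>M)\<bar>" for s n \<omega>
  have iN: "integrable M (N s n)" for s n unfolding N_def using ic by auto
  define W where "W n \<omega> = 2 * (\<Sum>t\<in>{1..int n}. g (Y t \<omega>)) + 2 * n * Eg + (\<Sum>s\<in>range q. N s n \<omega>)" for n \<omega>
  have iW: "integrable M (W n)" for n unfolding W_def using ig iN by auto
  have EW: "(\<integral>\<omega>. W n \<omega> \<partial>M) = 4 * n * Eg + (\<Sum>s\<in>range q. \<integral>\<omega>. N s n \<omega> \<partial>M)" for n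
    unfolding W_def using ig iN by (simp add: Egt prob_space)
  have "(\<lambda>n. (\<Sum>s\<in>range q. \<integral>\<omega>. N s n \<omega> \<partial>M) / n) \<longlonglongrightarrow> (\<Sum>s\<in>range q. 0)"
    unfolding sum_divide_distrib N_def using c1
    by (intro tendsto_sum ergodic_mean_convergence[OF assms(1,2) cm]) auto
  then have "\<forall>\<^sub>F n in sequentially. (\<Sum>s\<in>range q. \<integral>\<omega>. N s n \<omega> \<partial>M) / n < e / 2"
    using e by (intro order_tendstoD(2)) auto
  then obtain n0 where n0: "\<And>n. n \<ge> n0 \<Longrightarrow> (\<Sum>s\<in>range q. \<integral>\<omega>. N s n \<omega> \<partial>M) / n < e / 2"
    by (auto simp: eventually_sequentially)
  have W0: "0 \<le> W n \<omega>" for n \<omega>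
    unfolding W_def using g(1) by (auto intro!: add_nonneg_nonneg sum_nonneg mult_nonneg_nonneg Bochner_Integration.integral_nonneg simp: N_def Eg_def)
  have EW0: "0 \<le> (\<integral>\<omega>. W n \<omega> \<partial>M)" for n using W0 by (intro Bochner_Integration.integral_nonneg) auto
  \<comment> \<open>The mean of \<open>W n\<close> is at most \<open>e * n\<close> beyond \<open>n0\<close>; \<open>K\<close> dominates the finitely many others.\<close>
  define K where "K = (\<Sum>n\<le>n0. \<integral>\<omega>. W n \<omega> \<partial>M)"
  show ?thesis
  proof (rule that[OF iW])
    show "(\<integral>\<omega>. W n \<omega> \<partial>M) \<le> e * n + K" for n
    proof (cases "n \<le> n0")
      case True
      then have "(\<integral>\<omega>. W n \<omega> \<partial>M) \<le> K" unfolding K_def using EW0 by (intro member_le_sum) auto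
      then show ?thesis using e by (simp add: add_increasing)
    next
      case False
      then have "(\<Sum>s\<in>range q. \<integral>\<omega>. N s n \<omega> \<partial>M) \<le> e / 2 * n"
        using n0[of n] by (simp add: field_simps)
      moreover have "4 * n * Eg \<le> 4 * n * (e / 8)" using Eg by (intro mult_left_mono) auto
      ultimately have "(\<integral>\<omega>. W n \<omega> \<partial>M) \<le> e * n" unfolding EW by (simp add: field_simps)
      moreover have "0 \<le> K" unfolding K_def using EW0 by (intro sum_nonneg) auto
      ultimately show ?thesis by simp
    qed
  next
    fix n f \<omega> assume f: "bl_norm (f :: 'a \<Rightarrow> real) \<le> 1"
    note fm [measurable] = bl_norm_borel[OF f]
    have fq: "f (q x) = (\<Sum>s\<in>range q. f s * c s x)" for x
    proof -
      have "(\<Sum>s\<in>range q. f s * c s x) = (\<Sum>s\<in>range q. if s = q x then f s else 0)"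
        by (rule sum.cong) (auto simp: c_def)
      then show ?thesis using q(1) by simp
    qed
    have "\<bar>f x\<bar> \<le> 1" for x using bl_norm_le_1D(1)[OF f] .
    then have if1: "integrable M (\<lambda>\<omega>. f (Y 1 \<omega>))" and ifq: "integrable M (\<lambda>\<omega>. f (q (Y 1 \<omega>)))"
      by (auto intro!: integrable_const_bound[of _ 1])
    have fg: "\<bar>f x - f (q x)\<bar> \<le> 2 * g x" for x
      unfolding g_def by (rule bl_norm_le_1_min_dist[OF f])
    let ?E = "\<lambda>h. \<integral>\<omega>. h (Y 1 \<omega>) \<partial>M" and ?S = "\<lambda>h. \<Sum>t\<in>{1..int n}. h (Y t \<omega>)"
    have "\<bar>?S f - ?S (\<lambda>x. f (q x))\<bar> \<le> 2 * ?S g"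
      unfolding sum_subtractf[symmetric] sum_distrib_left
      by (rule order_trans[OF sum_abs sum_mono]) (rule fg)
    moreover have "\<bar>?E f - ?E (\<lambda>x. f (q x))\<bar> \<le> 2 * Eg"
    proof -
      have "\<bar>?E f - ?E (\<lambda>x. f (q x))\<bar> = \<bar>\<integral>\<omega>. f (Y 1 \<omega>) - f (q (Y 1 \<omega>)) \<partial>M\<bar>" using if1 ifq by simp
      also have "\<dots> \<le> (\<integral>\<omega>. \<bar>f (Y 1 \<omega>) - f (q (Y 1 \<omega>))\<bar> \<partial>M)" by (rule integral_abs_bound)
      also have "\<dots> \<le> (\<integral>\<omega>. 2 * g (Y 1 \<omega>) \<partial>M)" by (rule integral_mono) (use if1 ifq ig fg in auto)
      finally show ?thesis by (simp add: Eg_def)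
    qed
    then have "\<bar>n * ?E f - n * ?E (\<lambda>x. f (q x))\<bar> \<le> n * (2 * Eg)"
      by (simp add: abs_mult mult_left_mono flip: right_diff_distrib)
    moreover have "\<bar>?S (\<lambda>x. f (q x)) - n * ?E (\<lambda>x. f (q x))\<bar> \<le> (\<Sum>s\<in>range q. N s n \<omega>)"
    proof -
      have "?S (\<lambda>x. f (q x)) = (\<Sum>s\<in>range q. f s * ?S (c s))"
        unfolding fq sum_distrib_left by (rule sum.swap)
      moreover have "?E (\<lambda>x. f (q x)) = (\<Sum>s\<in>range q. f s * ?E (c s))"
        unfolding fq using ic by (subst Bochner_Integration.integral_sum) auto
      ultimately have "?S (\<lambda>x. f (q x)) - n * ?E (\<lambda>x. f (q x)) = (\<Sum>s\<in>range q. f s * (?S (c s) - n * ?E (c s)))"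
        by (simp add: sum_subtractf sum_distrib_left algebra_simps)
      also have "\<bar>\<dots>\<bar> \<le> (\<Sum>s\<in>range q. N s n \<omega>)"
      proof (rule order_trans[OF sum_abs sum_mono])
        show "\<bar>f s * (?S (c s) - n * ?E (c s))\<bar> \<le> N s n \<omega>" for s
          using bl_norm_le_1D(1)[OF f, of s] by (simp add: N_def abs_mult mult_left_le_one_le)
      qed
      finally show ?thesis .
    qed
    ultimately show "\<bar>?S f - n * ?E f\<bar> \<le> W n \<omega>" unfolding W_def by linarith
  qed
qed

section \<open>Blocks of consecutive times\<close>

text \<open>The times \<open>t\<close> in the block of index \<open>j\<close> are those with \<open>j / N < t / T \<le> (j + 1) / N\<close>.\<close>

lemma block_arith:
  assumes "1 \<le> T" "j < N" "t \<in> {int (j * T div N) + 1..int (Suc j * T div N)}"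
  shows "t \<in> {1..int T}" "\<bar>real_of_int t / T - Suc j / N\<bar> \<le> 1 / N"
proof -
  obtain s where s: "t = int s" using assms(3) by (cases t) auto
  have "j * T div N < s" "s \<le> Suc j * T div N" using assms(3) by (auto simp: s)
  then have lt: "j * T < s * N" and le: "s * N \<le> Suc j * T"
    using assms(2) by (auto simp: div_less_iff_less_mult less_eq_div_iff_mult_less_eq)
  have "Suc j * T \<le> N * T" using assms(2) by (intro mult_right_mono) auto
  then have "s * N \<le> T * N" using le by (metis mult.commute order_trans)
  then have "s \<le> T" using assms(2) by simp
  then show "t \<in> {1..int T}" using assms(3) by (simp add: s)
  have "real (j * T) < real (s * N)" "real (s * N) \<le> real (Suc j * T)"
    using lt le by (simp_all only: of_nat_less_iff of_nat_le_iff)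
  then have "real s / T \<le> Suc j / N" "j / N < real s / T"
    using assms(1,2) by (auto simp: field_simps)
  moreover have "real (Suc j) / N = j / N + 1 / N" by (simp add: add_divide_distrib)
  ultimately show "\<bar>real_of_int t / T - Suc j / N\<bar> \<le> 1 / N" by (simp add: s abs_le_iff)
qed

lemma real_div_bounds:
  fixes a N :: nat
  assumes "0 < N"
  shows "real (a div N) \<le> a / N" "a / N < real (a div N) + 1"
proof -
  have "real (a div N) = of_int \<lfloor>real a / real N\<rfloor>"
    by (simp add: floor_divide_of_nat_eq)
  then show "real (a div N) \<le> a / N" "a / N < real (a div N) + 1" by linarith+
qed

lemma abs_diff_chain:
  fixes a b c d e :: real
  assumes "\<bar>a - b\<bar> \<le> p" "\<bar>b - c\<bar> \<le> q" "\<bar>c - d\<bar> \<le> r" "\<bar>e - d\<bar> \<le> s"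
  shows "\<bar>a - e\<bar> \<le> p + q + r + s"
  using assms by linarith

lemma min_dist_triangle: "min (dist x z) 1 \<le> min (dist x y) 1 + min (dist y z) (1::real)"
  using dist_triangle[of x z y] zero_le_dist[of x y] zero_le_dist[of y z] by linarith

section \<open>Integrals against the empirical and the limit measures\<close>

lemma subprobsI:
  assumes "sets \<mu> = sets borel" "emeasure \<mu> UNIV \<le> 1"
  shows "\<mu> \<in> subprobs"
  using assms sets_eq_imp_space_eq[OF assms(1)]
  by (auto simp: space_subprob_algebra intro!: subprob_spaceI)

lemma sets_empirical_measure [simp]:
  fixes X :: "int \<Rightarrow> nat \<Rightarrow> 'w \<Rightarrow> 'a::topological_space"
  shows "sets (empirical_measure X T u \<omega>) = sets borel"
  using sets.sigma_sets_eq[of "borel :: 'a measure"] by (simp add: empirical_measure_def)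

lemma sets_limit_measure [simp]:
  fixes Z :: "int \<Rightarrow> real \<Rightarrow> 'w \<Rightarrow> 'a::topological_space"
  shows "sets (limit_measure M Z u) = sets borel"
  using sets.sigma_sets_eq[of "borel :: 'a measure"] by (simp add: limit_measure_def)

text \<open>Exhibiting the empirical measure as the image of a weighted counting measure makes the
  integral of a test function a finite sum.\<close>

lemma empirical_measure_eq_distr:
  "empirical_measure X T u \<omega> =
    distr (point_measure {1..\<lfloor>u * real T\<rfloor>} (\<lambda>_. ennreal (1 / real T))) borel (\<lambda>t. X t T \<omega>)"
    (is "_ = distr ?P borel ?X")
proof (rule measure_eqI)
  fix A assume "A \<in> sets (empirical_measure X T u \<omega>)"
  then have A: "A \<in> sets borel" by simp
  have "emeasure (distr ?P borel ?X) A = emeasure ?P ({1..\<lfloor>u * real T\<rfloor>} \<inter> {t. X t T \<omega> \<in> A})"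
    using A by (subst emeasure_distr) (auto simp: space_point_measure vimage_def Int_def conj_commute)
  also have "\<dots> = (\<Sum>t\<in>{1..\<lfloor>u * real T\<rfloor>} \<inter> {t. X t T \<omega> \<in> A}. ennreal (1 / real T))"
    by (rule emeasure_point_measure_finite) auto
  also have "\<dots> = (\<Sum>t\<in>{1..\<lfloor>u * real T\<rfloor>}. ennreal (1 / real T) * indicator A (X t T \<omega>))"
    by (rule sum.mono_neutral_cong_left) (auto simp: indicator_def)
  finally show "emeasure (empirical_measure X T u \<omega>) A = emeasure (distr ?P borel ?X) A"
    unfolding emeasure_empirical_measure[OF A] by (simp add: sum_distrib_left)
qed simp

lemma integral_empirical_measure:
  fixes f :: "'a::topological_space \<Rightarrow> real"
  assumes "f \<in> borel_measurable borel"
  shows "(\<integral>x. f x \<partial>empirical_measure X T u \<omega>) = (\<Sum>t\<in>{1..\<lfloor>u * real T\<rfloor>}. f (X t T \<omega>)) / T"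
  unfolding empirical_measure_eq_distr using assms
  by (subst integral_distr) (auto simp: lebesgue_integral_point_measure_finite sum_divide_distrib)

lemma empirical_measure_subprob:
  assumes "1 \<le> T" "u \<in> {0..1}"
  shows "empirical_measure X T u \<omega> \<in> subprobs"
proof (rule subprobsI)
  have "\<lfloor>u * real T\<rfloor> \<le> int T"
    using assms by (simp add: floor_le_iff mult_left_le_one_le order_le_less_trans[of _ "real T"])
  then have "(\<Sum>t\<in>{1..\<lfloor>u * real T\<rfloor>}. ennreal 1) \<le> of_nat T"
    by (auto intro!: of_nat_mono)
  then have "ennreal (1 / real T) * (\<Sum>t\<in>{1..\<lfloor>u * real T\<rfloor>}. ennreal 1) \<le> ennreal (1 / real T) * of_nat T"
    by (rule mult_left_mono) simp
  also have "\<dots> = 1" using assms(1) by (simp add: ennreal_of_nat_eq_real_of_nat flip: ennreal_mult)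
  finally show "emeasure (empirical_measure X T u \<omega>) UNIV \<le> 1"
    by (simp add: emeasure_empirical_measure)
qed simp

context
  fixes M :: "'w measure" and X :: "int \<Rightarrow> nat \<Rightarrow> 'w \<Rightarrow> 'a::polish_space" and Z :: "int \<Rightarrow> real \<Rightarrow> 'w \<Rightarrow> 'a"
  assumes M: "prob_space M" and LS: "locally_stationary M X Z"
begin

lemma stationary_aux: "u \<in> {0..1} \<Longrightarrow> stationary M (\<lambda>t. Z t u)"
  using LS by (simp add: locally_stationary_def)

lemma measurable_aux: "u \<in> {0..1} \<Longrightarrow> Z t u \<in> borel_measurable M"
  using stationary_measurable[OF stationary_aux] .

lemma measurable_aux_kernel:
  assumes "u \<in> {0..1}"
  shows "(\<lambda>\<eta>. distr M borel (Z 0 \<eta>)) \<in> restrict_space lborel {0..u} \<rightarrow>\<^sub>M subprob_algebra borel"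
proof (rule measurable_subprob_algebra)
  interpret prob_space M by (rule M)
  let ?R = "restrict_space lborel {0..u}"
  have sp: "space ?R = {0..u}" by (simp add: space_restrict_space)
  have sub: "\<eta> \<in> {0..1}" if "\<eta> \<in> space ?R" for \<eta> using that assms by (auto simp: sp)
  show "subprob_space (distr M borel (Z 0 \<eta>))" if "\<eta> \<in> space ?R" for \<eta>
    using prob_space_distr[OF measurable_aux[OF sub[OF that]]] by (rule prob_space_imp_subprob_space)
  fix A :: "'a set" assume A: "A \<in> sets borel"
  have "(\<lambda>\<eta>. emeasure M {\<omega> \<in> space M. Z 0 \<eta> \<omega> \<in> A}) \<in> borel_measurable (restrict_space borel {0..u})"
    by (rule measurable_restrict_mono[OF measurable_aux_law[OF M LS A]]) (use assms in auto)
  then have "(\<lambda>\<eta>. emeasure M {\<omega> \<in> space M. Z 0 \<eta> \<omega> \<in> A}) \<in> borel_measurable ?R"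
    by (subst measurable_cong_sets[OF sets_restrict_space_cong[OF sets_lborel] refl])
  also have "?this \<longleftrightarrow> (\<lambda>\<eta>. emeasure (distr M borel (Z 0 \<eta>)) A) \<in> borel_measurable ?R"
    using A by (intro measurable_cong, subst emeasure_distr[OF measurable_aux[OF sub]])
      (auto simp: vimage_def Int_def conj_commute)
  finally show "(\<lambda>\<eta>. emeasure (distr M borel (Z 0 \<eta>)) A) \<in> borel_measurable ?R" .
qed simp

text \<open>As a mixture of the laws of \<open>Z\<^sub>0(\<eta>)\<close>, the limit measure has integrals that are computed by
  Fubini's theorem for kernels.\<close>

lemma limit_measure_eq_bind:
  assumes u: "u \<in> {0..1}"
  shows "limit_measure M Z u = Giry_Monad.bind (restrict_space lborel {0..u}) (\<lambda>\<eta>. distr M borel (Z 0 \<eta>))"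
    (is "_ = Giry_Monad.bind ?R ?k")
proof (rule measure_eqI)
  have ne: "space ?R \<noteq> {}" using u by (simp add: space_restrict_space)
  note k = measurable_aux_kernel[OF u]
  show s: "sets (limit_measure M Z u) = sets (Giry_Monad.bind ?R ?k)"
    using sets_bind[OF sets_kernel[OF k] ne] by simp
  fix A assume "A \<in> sets (limit_measure M Z u)"
  then have A: "A \<in> sets borel" by simp
  have "emeasure (Giry_Monad.bind ?R ?k) A = (\<integral>\<^sup>+\<eta>. emeasure (?k \<eta>) A \<partial>?R)"
    by (rule emeasure_bind[OF ne k A])
  also have "\<dots> = (\<integral>\<^sup>+\<eta>\<in>{0..u}. emeasure (?k \<eta>) A \<partial>lborel)"
    by (subst nn_integral_restrict_space) auto
  also have "\<dots> = (\<integral>\<^sup>+\<eta>\<in>{0..u}. emeasure M {\<omega> \<in> space M. Z 0 \<eta> \<omega> \<in> A} \<partial>lborel)"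
    using u A by (intro nn_integral_cong)
      (auto simp: indicator_def emeasure_distr measurable_aux vimage_def Int_def conj_commute)
  finally show "emeasure (limit_measure M Z u) A = emeasure (Giry_Monad.bind ?R ?k) A"
    by (simp add: emeasure_limit_measure[OF M LS u A])
qed

lemma limit_measure_subprob:
  assumes "u \<in> {0..1}"
  shows "limit_measure M Z u \<in> subprobs"
proof (rule subprobsI)
  interpret prob_space M by (rule M)
  have "emeasure (limit_measure M Z u) UNIV = ennreal u"
    using assms by (simp add: emeasure_limit_measure[OF M LS] emeasure_space_1)
  then show "emeasure (limit_measure M Z u) UNIV \<le> 1" using assms by (simp add: ennreal_le_1)
qed simp

lemma aux_lipschitz:
  obtains C where "0 \<le> C" "\<And>t u v. 1 \<le> t \<Longrightarrow> u \<in> {0..1} \<Longrightarrow> v \<in> {0..1} \<Longrightarrow>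
      (\<integral>\<omega>. min (dist (Z t u \<omega>) (Z t v \<omega>)) 1 \<partial>M) \<le> C * \<bar>u - v\<bar>"
proof -
  obtain C where C: "\<And>T t u v. 1 \<le> T \<Longrightarrow> t \<in> {1..int T} \<Longrightarrow> u \<in> {0..1} \<Longrightarrow> v \<in> {0..1} \<Longrightarrow>
       (\<integral>\<omega>. min (dist (Z t u \<omega>) (Z t v \<omega>)) 1 \<partial>M) \<le> C * \<bar>u - v\<bar>"
    using LS unfolding locally_stationary_def by blast
  show ?thesis
  proof (rule that[of "max 0 C"])
    fix t :: int and u v :: real assume *: "1 \<le> t" "u \<in> {0..1}" "v \<in> {0..1}"
    have "(\<integral>\<omega>. min (dist (Z t u \<omega>) (Z t v \<omega>)) 1 \<partial>M) \<le> C * \<bar>u - v\<bar>"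
      using * by (intro C[of "nat t"]) auto
    also have "\<dots> \<le> max 0 C * \<bar>u - v\<bar>" by (rule mult_right_mono) auto
    finally show "(\<integral>\<omega>. min (dist (Z t u \<omega>) (Z t v \<omega>)) 1 \<partial>M) \<le> max 0 C * \<bar>u - v\<bar>" .
  qed simp
qed

lemma array_approximation:
  obtains C where "0 \<le> C" "\<And>T t. t \<in> {1..int T} \<Longrightarrow>
      (\<integral>\<omega>. min (dist (X t T \<omega>) (Z t (t / T) \<omega>)) 1 \<partial>M) \<le> C / T"
proof -
  obtain C where C: "\<And>T t. 1 \<le> T \<Longrightarrow> t \<in> {1..int T} \<Longrightarrow>
       (\<integral>\<omega>. min (dist (X t T \<omega>) (Z t (t / T) \<omega>)) 1 \<partial>M) \<le> C / T"
    using LS unfolding locally_stationary_def by blast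
  show ?thesis
  proof (rule that[of "max 0 C"])
    fix T :: nat and t :: int assume *: "t \<in> {1..int T}"
    have "(\<integral>\<omega>. min (dist (X t T \<omega>) (Z t (t / T) \<omega>)) 1 \<partial>M) \<le> C / T"
      using * by (intro C) auto
    also have "\<dots> \<le> max 0 C / T" by (rule divide_right_mono) auto
    finally show "(\<integral>\<omega>. min (dist (X t T \<omega>) (Z t (t / T) \<omega>)) 1 \<partial>M) \<le> max 0 C / T" .
  qed simp
qed

lemma bl_aux_integrable:
  assumes "bl_norm f \<le> 1" "u \<in> {0..1}"
  shows "integrable M (\<lambda>\<omega>. f (Z t u \<omega>))" "\<bar>\<integral>\<omega>. f (Z t u \<omega>) \<partial>M\<bar> \<le> 1"
proof -
  interpret prob_space M by (rule M)
  note [measurable] = measurable_aux[OF assms(2)] bl_norm_borel[OF assms(1)]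
  show i: "integrable M (\<lambda>\<omega>. f (Z t u \<omega>))"
    by (rule integrable_const_bound[of _ 1]) (use bl_norm_le_1D(1)[OF assms(1)] in auto)
  have "\<bar>\<integral>\<omega>. f (Z t u \<omega>) \<partial>M\<bar> \<le> (\<integral>\<omega>. \<bar>f (Z t u \<omega>)\<bar> \<partial>M)" by (rule integral_abs_bound)
  also have "\<dots> \<le> (\<integral>\<omega>. 1 \<partial>M)"
    by (rule integral_mono) (use i bl_norm_le_1D(1)[OF assms(1)] in auto)
  finally show "\<bar>\<integral>\<omega>. f (Z t u \<omega>) \<partial>M\<bar> \<le> 1" by (simp add: prob_space)
qed

text \<open>Time \<open>1\<close> replaces time \<open>0\<close>, which is harmless by stationarity: the Lipschitz condition in
  the rescaled time concerns the times \<open>t \<ge> 1\<close>, and the law of large numbers is centred at time \<open>1\<close>.\<close>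

lemma integral_limit_measure:
  assumes f: "bl_norm f \<le> 1" and u: "u \<in> {0..1}"
  shows "set_integrable lborel {0..u} (\<lambda>\<eta>. \<integral>\<omega>. f (Z 1 \<eta> \<omega>) \<partial>M)"
    and "(\<integral>x. f x \<partial>limit_measure M Z u) = (LINT \<eta>:{0..u}|lborel. \<integral>\<omega>. f (Z 1 \<eta> \<omega>) \<partial>M)"
proof -
  interpret prob_space M by (rule M)
  note [measurable] = bl_norm_borel[OF f]
  let ?R = "restrict_space lborel {0..u}" and ?k = "\<lambda>\<eta>. distr M borel (Z 0 \<eta>)"
  have fin: "finite_measure ?R"
    by (rule finite_measureI) (use u in \<open>simp add: emeasure_restrict_space space_restrict_space\<close>)
  have sp: "space ?R = {0..u}" by (simp add: space_restrict_space)
  have eq: "(\<integral>x. f x \<partial>?k \<eta>) = (\<integral>\<omega>. f (Z 1 \<eta> \<omega>) \<partial>M)" if "\<eta> \<in> space ?R" for \<eta>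
  proof -
    have \<eta>: "\<eta> \<in> {0..1}" using that u by (auto simp: sp)
    show ?thesis using stationary_integral[OF stationary_aux[OF \<eta>], of f 0 1]
      by (simp add: integral_distr measurable_aux[OF \<eta>])
  qed
  have B: "AE \<eta> in ?R. emeasure (?k \<eta>) (space (?k \<eta>)) \<le> ennreal 1"
  proof (rule AE_I2)
    fix \<eta> assume "\<eta> \<in> space ?R"
    then have "Z 0 \<eta> \<in> borel_measurable M" using u by (intro measurable_aux) (auto simp: sp)
    then interpret K: prob_space "?k \<eta>" by (rule prob_space_distr)
    show "emeasure (?k \<eta>) (space (?k \<eta>)) \<le> ennreal 1" using K.emeasure_space_1 by simp
  qed
  have "(\<integral>x. f x \<partial>limit_measure M Z u) = (\<integral>\<eta>. (\<integral>x. f x \<partial>?k \<eta>) \<partial>?R)"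
    unfolding limit_measure_eq_bind[OF u]
    by (rule integral_bind[OF _ _ measurable_aux_kernel[OF u] fin B, where B=1])
      (use bl_norm_le_1D(1)[OF f] in auto)
  also have "\<dots> = (\<integral>\<eta>. (\<integral>\<omega>. f (Z 1 \<eta> \<omega>) \<partial>M) \<partial>?R)"
    by (rule Bochner_Integration.integral_cong[OF refl eq])
  finally show "(\<integral>x. f x \<partial>limit_measure M Z u) = (LINT \<eta>:{0..u}|lborel. \<integral>\<omega>. f (Z 1 \<eta> \<omega>) \<partial>M)"
    by (simp add: integral_restrict_space set_lebesgue_integral_def)
  have "(\<lambda>\<eta>. \<integral>x. f x \<partial>?k \<eta>) \<in> borel_measurable ?R"
    by (rule measurable_compose[OF measurable_aux_kernel[OF u] integral_measurable_subprob_algebra]) simp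
  then have m: "(\<lambda>\<eta>. \<integral>\<omega>. f (Z 1 \<eta> \<omega>) \<partial>M) \<in> borel_measurable ?R"
    by (subst (asm) measurable_cong[OF eq])
  have "integrable ?R (\<lambda>\<eta>. \<integral>\<omega>. f (Z 1 \<eta> \<omega>) \<partial>M)"
    by (rule finite_measure.integrable_const_bound[OF fin, where B=1])
      (use u bl_aux_integrable(2)[OF f] m in \<open>auto simp: sp intro!: AE_I2\<close>)
  then show "set_integrable lborel {0..u} (\<lambda>\<eta>. \<integral>\<omega>. f (Z 1 \<eta> \<omega>) \<partial>M)"
    by (simp add: integrable_restrict_space set_integrable_def)
qed

text \<open>For \<open>m = 0\<close> and \<open>c = 1\<close> this is the Lipschitz bound for the limit path; for \<open>m\<close> the mean at
  the right end point it is the error of a single term of a Riemann sum.\<close>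

lemma integral_limit_measure_increment:
  assumes f: "bl_norm f \<le> 1" and uv: "0 \<le> u" "u \<le> v" "v \<le> 1"
    and c: "\<And>\<eta>. \<eta> \<in> {u..v} \<Longrightarrow> \<bar>(\<integral>\<omega>. f (Z 1 \<eta> \<omega>) \<partial>M) - m\<bar> \<le> c"
  shows "\<bar>(\<integral>x. f x \<partial>limit_measure M Z v) - (\<integral>x. f x \<partial>limit_measure M Z u) - (v - u) * m\<bar> \<le> (v - u) * c"
proof -
  let ?h = "\<lambda>\<eta>. \<integral>\<omega>. f (Z 1 \<eta> \<omega>) \<partial>M"
  have i: "set_integrable lborel {0..v} ?h" "set_integrable lborel {0..u} ?h"
    using uv by (auto intro!: integral_limit_measure[OF f])
  have i': "set_integrable lborel {u<..v} ?h"
    using i(1) by (rule set_integrable_subset) (use uv in auto)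
  have const: "set_integrable lborel {u<..v} (\<lambda>_. k :: real)" for k
    using uv by (auto simp: set_integrable_def intro!: integrable_mult_left integrable_real_indicator)
  have "{0..v} = {0..u} \<union> {u<..v}" "{0..u} \<inter> {u<..v} = {}" using uv by auto
  then have "(LINT \<eta>:{0..v}|lborel. ?h \<eta>) = (LINT \<eta>:{0..u}|lborel. ?h \<eta>) + (LINT \<eta>:{u<..v}|lborel. ?h \<eta>)"
    using set_integral_Un[OF _ i(2) i'] by simp
  then have "(\<integral>x. f x \<partial>limit_measure M Z v) - (\<integral>x. f x \<partial>limit_measure M Z u) = (LINT \<eta>:{u<..v}|lborel. ?h \<eta>)"
    using uv by (simp add: integral_limit_measure(2)[OF f])
  also have "\<dots> - (v - u) * m = (LINT \<eta>:{u<..v}|lborel. ?h \<eta> - m)"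
    using set_integral_diff(2)[OF i' const[of m]] uv by (simp add: set_lebesgue_integral_def)
  finally have "\<bar>(\<integral>x. f x \<partial>limit_measure M Z v) - (\<integral>x. f x \<partial>limit_measure M Z u) - (v - u) * m\<bar>
      = \<bar>LINT \<eta>:{u<..v}|lborel. ?h \<eta> - m\<bar>" by simp
  also have "\<dots> \<le> (LINT \<eta>:{u<..v}|lborel. \<bar>?h \<eta> - m\<bar>)"
    using integral_norm_bound[of lborel "\<lambda>\<eta>. indicator {u<..v} \<eta> *\<^sub>R (?h \<eta> - m)"]
    by (simp add: set_lebesgue_integral_def abs_mult)
  also have "\<dots> \<le> (LINT \<eta>:{u<..v}|lborel. c)"
  proof (rule set_integral_mono)
    have "set_integrable lborel {u<..v} (\<lambda>\<eta>. ?h \<eta> - m)"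
      using i' const by (rule set_integral_diff(1))
    then show "set_integrable lborel {u<..v} (\<lambda>\<eta>. \<bar>?h \<eta> - m\<bar>)"
      by (rule set_integrable_abs)
  qed (use c const in auto)
  also have "\<dots> = (v - u) * c" using uv by (simp add: set_lebesgue_integral_def)
  finally show ?thesis .
qed

lemma bl_dist_limit_measure_le:
  assumes uv: "u \<in> {0..1}" "v \<in> {0..1}"
  shows "bl_dist (limit_measure M Z u) (limit_measure M Z v) \<le> \<bar>u - v\<bar>"
proof -
  have *: "bl_dist (limit_measure M Z v) (limit_measure M Z u) \<le> v - u"
    if "u \<in> {0..1}" "v \<in> {0..1}" "u \<le> v" for u v
  proof (rule bl_dist_le)
    fix f :: "'a \<Rightarrow> real" assume f: "bl_norm f \<le> 1"
    have "\<bar>(\<integral>x. f x \<partial>limit_measure M Z v) - (\<integral>x. f x \<partial>limit_measure M Z u) - (v - u) * 0\<bar> \<le> (v - u) * 1"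
      by (rule integral_limit_measure_increment[OF f])
        (use that bl_aux_integrable(2)[OF f] in \<open>auto intro: order_trans\<close>)
    then show "\<bar>(\<integral>x. f x \<partial>limit_measure M Z v) - (\<integral>x. f x \<partial>limit_measure M Z u)\<bar> \<le> v - u" by simp
  qed (use that in simp)
  show ?thesis
    using *[OF uv] *[OF uv(2,1)] bl_dist_commute[of "limit_measure M Z u" "limit_measure M Z v"]
    by (cases "u \<le> v") auto
qed

lemma limit_path_continuous: "limit_path M Z \<in> continuous_paths bl_topology"
proof -
  interpret B: Metric_space "subprobs :: 'a measure set" bl_dist by (rule Metric_space_bl_dist)
  have mem: "limit_path M Z u \<in> subprobs" if "u \<in> {0..1}" for u
    using limit_measure_subprob[OF that] that by simp
  have "continuous_map (top_of_set {0..1}) bl_topology (limit_path M Z)"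
    unfolding B.continuous_map_to_metric
  proof (intro ballI allI impI)
    fix u e :: real assume "u \<in> topspace (top_of_set {0..1})" and e: "0 < e"
    then have u: "u \<in> {0..1}" by simp
    show "\<exists>U. openin (top_of_set {0..1}) U \<and> u \<in> U \<and> (\<forall>v\<in>U. limit_path M Z v \<in> B.mball (limit_path M Z u) e)"
    proof (intro exI conjI ballI)
      show "openin (top_of_set {0..1}) ({0..1} \<inter> ball u e)" by (simp add: openin_open_Int)
      show "u \<in> {0..1} \<inter> ball u e" using u e by simp
      fix v assume v: "v \<in> {0..1} \<inter> ball u e"
      then have "bl_dist (limit_measure M Z u) (limit_measure M Z v) < e"
        using bl_dist_limit_measure_le[OF u, of v] by (auto simp: dist_real_def)
      then show "limit_path M Z v \<in> B.mball (limit_path M Z u) e"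
        using mem[of u] mem[of v] u v by (simp add: B.in_mball)
    qed
  qed
  moreover have "limit_path M Z \<in> {0..1} \<rightarrow>\<^sub>E topspace bl_topology"
    unfolding topspace_bl_topology using mem by auto
  ultimately show ?thesis by (simp add: continuous_paths_def)
qed

section \<open>A uniform bound for the empirical measure\<close>

lemma integrable_min_dist:
  fixes Y Y' :: "'w \<Rightarrow> 'a"
  assumes [measurable]: "Y \<in> borel_measurable M" "Y' \<in> borel_measurable M"
  shows "integrable M (\<lambda>\<omega>. min (dist (Y \<omega>) (Y' \<omega>)) 1)"
proof -
  interpret prob_space M by (rule M)
  show ?thesis by (rule integrable_const_bound[of _ 1]) auto
qed

lemma measurable_array: "1 \<le> T \<Longrightarrow> X t T \<in> borel_measurable M"
  using LS by (simp add: locally_stationary_def)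

text \<open>Four replacements on one block: \<open>X\<^sub>t\<^sub>,\<^sub>T\<close> by \<open>Z\<^sub>t(v)\<close> for the right end point \<open>v\<close> of the cell; the block sum of
  \<open>f (Z\<^sub>t(v))\<close>, a difference of two initial sums, by the number of terms times the mean; that number
  by \<open>T / N\<close>, from which it differs by at most \<open>1\<close>; and the Riemann term by the increment
  of the integral.\<close>

lemma block_estimate:
  fixes W :: "nat \<Rightarrow> real"
  assumes f: "bl_norm f \<le> 1" and T: "1 \<le> T" and j: "j < N"
    and C: "\<And>u v. u \<in> {0..1} \<Longrightarrow> v \<in> {0..1} \<Longrightarrow>
      (\<integral>\<omega>. min (dist (Z 1 u \<omega>) (Z 1 v \<omega>)) 1 \<partial>M) \<le> C * \<bar>u - v\<bar>" "0 \<le> C"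
    and W: "\<And>n. \<bar>(\<Sum>t\<in>{1..int n}. f (Z t (Suc j / N) \<omega>))
      - n * (\<integral>\<omega>. f (Z 1 (Suc j / N) \<omega>) \<partial>M)\<bar> \<le> W n"
  defines "B \<equiv> {int (j * T div N) + 1..int (Suc j * T div N)}"
  shows "\<bar>(\<Sum>t\<in>B. f (X t T \<omega>)) -
      T * ((\<integral>x. f x \<partial>limit_measure M Z (Suc j / N)) - (\<integral>x. f x \<partial>limit_measure M Z (j / N)))\<bar>
    \<le> 2 * (\<Sum>t\<in>B. min (dist (X t T \<omega>) (Z t (Suc j / N) \<omega>)) 1)
      + W (j * T div N) + W (Suc j * T div N) + 1 + 2 * C * T / (real N)\<^sup>2"
proof -
  let ?v = "real (Suc j) / real N" and ?u = "real j / real N"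
  let ?a = "j * T div N" and ?b = "Suc j * T div N"
  let ?I = "\<lambda>u. \<integral>x. f x \<partial>limit_measure M Z u"
  define m where "m = (\<integral>\<omega>. f (Z 1 ?v \<omega>) \<partial>M)"
  have v: "?v \<in> {0..1}" "?u \<in> {0..1}" "?u \<le> ?v" and vu: "?v - ?u = 1 / N"
    using j by (auto simp: field_simps)
  have ab: "?a \<le> ?b" by (intro div_le_mono) simp
  have 1: "\<bar>(\<Sum>t\<in>B. f (X t T \<omega>)) - (\<Sum>t\<in>B. f (Z t ?v \<omega>))\<bar>
      \<le> 2 * (\<Sum>t\<in>B. min (dist (X t T \<omega>) (Z t ?v \<omega>)) 1)"
    unfolding sum_subtractf[symmetric] sum_distrib_left
    by (rule order_trans[OF sum_abs sum_mono]) (rule bl_norm_le_1_min_dist[OF f])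
  have "{1..int ?b} = {1..int ?a} \<union> B" "{1..int ?a} \<inter> B = {}" using ab by (auto simp: B_def)
  then have "(\<Sum>t\<in>{1..int ?b}. f (Z t ?v \<omega>)) = (\<Sum>t\<in>{1..int ?a}. f (Z t ?v \<omega>)) + (\<Sum>t\<in>B. f (Z t ?v \<omega>))"
    by (simp add: sum.union_disjoint B_def)
  then have 2: "\<bar>(\<Sum>t\<in>B. f (Z t ?v \<omega>)) - (real ?b - real ?a) * m\<bar> \<le> W ?a + W ?b"
    using W[of ?a] W[of ?b] unfolding m_def left_diff_distrib by linarith
  have N: "0 < N" using j by simp
  have "\<bar>(real ?b - real ?a) - T / N\<bar> \<le> 1"
    using real_div_bounds[OF N, of "j * T"] real_div_bounds[OF N, of "Suc j * T"]
    by (simp add: field_simps add_divide_distrib)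
  then have "\<bar>((real ?b - real ?a) - T / N) * m\<bar> \<le> 1"
    unfolding abs_mult m_def using bl_aux_integrable(2)[OF f v(1), of 1] by (intro mult_le_one) auto
  then have 3: "\<bar>(real ?b - real ?a) * m - T / N * m\<bar> \<le> 1" by (simp add: left_diff_distrib)
  have c: "\<bar>(\<integral>\<omega>. f (Z 1 \<eta> \<omega>) \<partial>M) - m\<bar> \<le> 2 * C / N" if \<eta>: "\<eta> \<in> {?u..?v}" for \<eta>
  proof -
    have \<eta>1: "\<eta> \<in> {0..1}" proof -
      have "0 \<le> ?u" by simp
      then show ?thesis using \<eta> v(1) unfolding atLeastAtMost_iff by linarith
    qed
    have i: "integrable M (\<lambda>\<omega>. f (Z 1 \<eta> \<omega>))" "integrable M (\<lambda>\<omega>. f (Z 1 ?v \<omega>))"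
      by (intro bl_aux_integrable(1)[OF f] \<eta>1 v)+
    have "\<bar>(\<integral>\<omega>. f (Z 1 \<eta> \<omega>) \<partial>M) - m\<bar> = \<bar>\<integral>\<omega>. f (Z 1 \<eta> \<omega>) - f (Z 1 ?v \<omega>) \<partial>M\<bar>"
      unfolding m_def using i by simp
    also have "\<dots> \<le> (\<integral>\<omega>. \<bar>f (Z 1 \<eta> \<omega>) - f (Z 1 ?v \<omega>)\<bar> \<partial>M)" by (rule integral_abs_bound)
    also have "\<dots> \<le> (\<integral>\<omega>. 2 * min (dist (Z 1 \<eta> \<omega>) (Z 1 ?v \<omega>)) 1 \<partial>M)"
      using i integrable_min_dist[OF measurable_aux[OF \<eta>1] measurable_aux[OF v(1)]]
        bl_norm_le_1_min_dist[OF f] by (intro integral_mono) auto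
    also have "\<dots> \<le> 2 * (C * \<bar>\<eta> - ?v\<bar>)" using C(1)[OF \<eta>1 v(1)] by simp
    also have "\<dots> \<le> 2 * (C * (1 / N))"
      using \<eta> vu C(2) by (intro mult_left_mono) auto
    finally show ?thesis by simp
  qed
  have "\<bar>?I ?v - ?I ?u - (?v - ?u) * m\<bar> \<le> (?v - ?u) * (2 * C / N)"
    by (rule integral_limit_measure_increment[OF f _ v(3) _ c]) (use v in auto)
  then have "T * \<bar>?I ?v - ?I ?u - 1 / N * m\<bar> \<le> T * (1 / N * (2 * C / N))"
    unfolding vu by (intro mult_left_mono) auto
  then have "\<bar>T * (?I ?v - ?I ?u - 1 / N * m)\<bar> \<le> 2 * C * T / (real N)\<^sup>2"
    by (simp add: abs_mult power2_eq_square mult.commute mult.left_commute)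
  then have 4: "\<bar>T * (?I ?v - ?I ?u) - T / N * m\<bar> \<le> 2 * C * T / (real N)\<^sup>2"
    by (simp add: right_diff_distrib)
  show ?thesis using abs_diff_chain[OF 1 2 3 4] by (simp only: add.assoc)
qed

text \<open>Summing the block estimates bounds the error at the grid points \<open>k / N\<close>.  Between grid points
  the limit path moves by at most \<open>1 / N\<close> and the empirical path by at most \<open>1 / N + 1 / T\<close>.  The
  numbers of terms in the blocks telescope to \<open>T\<close>, so the replacement of \<open>X\<^sub>t\<^sub>,\<^sub>T\<close> by \<open>Z\<^sub>t(v)\<close> costs a mean of order
  \<open>1 / T + 1 / N\<close> in total rather than per block.\<close>

lemma uniform_bound_in_mean:
  assumes erg: "\<And>u. u \<in> {0..1} \<Longrightarrow> ergodic M (\<lambda>t. Z t u)" and \<delta>: "0 < \<delta>"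
  obtains R :: "nat \<Rightarrow> 'w \<Rightarrow> real" and K :: real
  where "\<And>T. 1 \<le> T \<Longrightarrow> integrable M (R T)"
    "\<And>T u \<omega>. 1 \<le> T \<Longrightarrow> u \<in> {0..1} \<Longrightarrow>
      bl_dist (empirical_measure X T u \<omega>) (limit_measure M Z u) \<le> R T \<omega>"
    "\<And>T. 1 \<le> T \<Longrightarrow> (\<integral>\<omega>. R T \<omega> \<partial>M) \<le> \<delta> + K / T"
proof -
  interpret prob_space M by (rule M)
  obtain C where C: "0 \<le> C" "\<And>t u v. 1 \<le> t \<Longrightarrow> u \<in> {0..1} \<Longrightarrow> v \<in> {0..1} \<Longrightarrow>
      (\<integral>\<omega>. min (dist (Z t u \<omega>) (Z t v \<omega>)) 1 \<partial>M) \<le> C * \<bar>u - v\<bar>"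
    using aux_lipschitz by blast
  obtain C' where C': "0 \<le> C'" "\<And>T t. t \<in> {1..int T} \<Longrightarrow>
      (\<integral>\<omega>. min (dist (X t T \<omega>) (Z t (t / T) \<omega>)) 1 \<partial>M) \<le> C' / T"
    using array_approximation by blast
  obtain N :: nat where N': "2 * (4 * C + 2) / \<delta> < N" using reals_Archimedean2 by blast
  moreover have "0 < 2 * (4 * C + 2) / \<delta>" using C(1) \<delta> by simp
  ultimately have N0: "0 < real N" by linarith
  have N: "0 < N" "(4 * C + 2) / N < \<delta> / 2"
  proof -
    show "0 < N" using N0 by simp
    have "2 * (4 * C + 2) < N * \<delta>" using N' \<delta> by (simp only: divide_less_eq if_True)
    then have "4 * C + 2 < \<delta> / 2 * N" by (simp add: mult.commute)
    then show "(4 * C + 2) / N < \<delta> / 2" using N0 by (simp only: divide_less_eq if_True)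
  qed
  \<comment> \<open>Each of the \<open>N\<close> blocks uses the law of large numbers at both of its ends, at a mean cost of
    \<open>e\<close> each after division by \<open>T\<close>, up to order \<open>1 / T\<close>; in total this is \<open>2 * N * e = \<delta> / 2\<close>.\<close>
  define e where "e = \<delta> / (4 * N)"
  have e: "0 < e" using \<delta> N by (simp add: e_def)
  let ?v = "\<lambda>j. real (Suc j) / real N"
  have v: "?v j \<in> {0..1}" if "j < N" for j using that by (auto simp: field_simps)
  define good where "good j W K \<longleftrightarrow> (\<forall>n. integrable M (W n)) \<and>
      (\<forall>n f \<omega>. bl_norm f \<le> 1 \<longrightarrow>
        \<bar>(\<Sum>t\<in>{1..int n}. f (Z t (?v j) \<omega>)) - n * (\<integral>\<omega>. f (Z 1 (?v j) \<omega>) \<partial>M)\<bar> \<le> W n \<omega>) \<and>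
      (\<forall>n. (\<integral>\<omega>. W n \<omega> \<partial>M) \<le> e * n + K)" for j and W :: "nat \<Rightarrow> 'w \<Rightarrow> real" and K :: real
  have "\<exists>W K. good j W K" if "j < N" for j
    by (rule ergodic_bl_law_of_large_numbers[OF M erg[OF v[OF that]] e]) (use good_def in blast)
  then obtain W K where WK: "\<And>j. j < N \<Longrightarrow> good j (W j) (K j)" by metis
  have iW: "\<And>j n. j < N \<Longrightarrow> integrable M (W j n)"
    and W: "\<And>j n f \<omega>. j < N \<Longrightarrow> bl_norm f \<le> 1 \<Longrightarrow>
      \<bar>(\<Sum>t\<in>{1..int n}. f (Z t (?v j) \<omega>)) - n * (\<integral>\<omega>. f (Z 1 (?v j) \<omega>) \<partial>M)\<bar> \<le> W j n \<omega>"
    and EW: "\<And>j n. j < N \<Longrightarrow> (\<integral>\<omega>. W j n \<omega> \<partial>M) \<le> e * n + K j"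
    using WK unfolding good_def by blast+
  define a where "a T j = j * T div N" for T j :: nat
  define B where "B T j = {int (a T j) + 1..int (a T (Suc j))}" for T j
  define D where "D T j \<omega> = (\<Sum>t\<in>B T j. min (dist (X t T \<omega>) (Z t (?v j) \<omega>)) 1)" for T j \<omega>
  define G where "G T j \<omega> = 2 * D T j \<omega> + W j (a T j) \<omega> + W j (a T (Suc j)) \<omega> + 1 + 2 * C * T / (real N)\<^sup>2" for T j \<omega>
  define R where "R T \<omega> = ((\<Sum>j<N. G T j \<omega>) + T / N + 1) / T + 1 / N" for T \<omega>
  have a_le: "a T j \<le> T" if "j \<le> N" for T j
    unfolding a_def using that div_le_mono[of "j * T" "N * T" N] N by simp
  have a_mono: "a T j \<le> a T (Suc j)" for T j unfolding a_def by (intro div_le_mono) simp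
  have card_B: "real (card (B T j)) = real (a T (Suc j)) - real (a T j)" for T j
    using a_mono[of T j] by (simp add: B_def of_nat_diff)
  have ix: "integrable M (\<lambda>\<omega>. min (dist (X t T \<omega>) (Z t (?v j) \<omega>)) 1)" if "1 \<le> T" "j < N" for t T j
    using measurable_array[OF that(1)] measurable_aux[OF v[OF that(2)]] by (rule integrable_min_dist)
  have iD: "integrable M (D T j)" if "1 \<le> T" "j < N" for T j
    unfolding D_def using ix[OF that] by auto
  have iG: "integrable M (G T j)" if "1 \<le> T" "j < N" for T j
    unfolding G_def using iD[OF that] iW[OF that(2)] by auto
  have ED: "(\<integral>\<omega>. D T j \<omega> \<partial>M) \<le> (real (a T (Suc j)) - real (a T j)) * (C' / T + C / N)"
    if T: "1 \<le> T" and j: "j < N" for T j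
  proof -
    have "(\<integral>\<omega>. min (dist (X t T \<omega>) (Z t (?v j) \<omega>)) 1 \<partial>M) \<le> C' / T + C / N" if "t \<in> B T j" for t
    proof -
      have t: "t \<in> {1..int T}" "\<bar>t / T - ?v j\<bar> \<le> 1 / N"
        using block_arith[OF T j] that by (auto simp: B_def a_def)
      have tT: "real_of_int t / T \<in> {0..1}" using t(1) by (auto simp: field_simps)
      have i1: "integrable M (\<lambda>\<omega>. min (dist (X t T \<omega>) (Z t (t / T) \<omega>)) 1)"
        and i2: "integrable M (\<lambda>\<omega>. min (dist (Z t (t / T) \<omega>) (Z t (?v j) \<omega>)) 1)"
        using integrable_min_dist[OF measurable_array[OF T] measurable_aux[OF tT]]
          integrable_min_dist[OF measurable_aux[OF tT] measurable_aux[OF v[OF j]]] by auto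
      have "(\<integral>\<omega>. min (dist (X t T \<omega>) (Z t (?v j) \<omega>)) 1 \<partial>M)
          \<le> (\<integral>\<omega>. min (dist (X t T \<omega>) (Z t (t / T) \<omega>)) 1 + min (dist (Z t (t / T) \<omega>) (Z t (?v j) \<omega>)) 1 \<partial>M)"
      proof (rule integral_mono[OF ix[OF T j] Bochner_Integration.integrable_add[OF i1 i2]])
        fix \<omega>
        show "min (dist (X t T \<omega>) (Z t (?v j) \<omega>)) 1
          \<le> min (dist (X t T \<omega>) (Z t (t / T) \<omega>)) 1 + min (dist (Z t (t / T) \<omega>) (Z t (?v j) \<omega>)) 1"
          by (rule min_dist_triangle)
      qed
      also have "\<dots> \<le> C' / T + C * \<bar>t / T - ?v j\<bar>"
        using i1 i2 C'(2)[OF t(1)] C(2)[OF _ tT v[OF j], of t] t(1) by simp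
      also have "\<dots> \<le> C' / T + C * (1 / N)" using t(2) C(1) by (intro add_left_mono mult_left_mono)
      finally show ?thesis by simp
    qed
    then have "(\<integral>\<omega>. D T j \<omega> \<partial>M) \<le> real (card (B T j)) * (C' / T + C / N)"
      unfolding D_def using ix[OF T j]
      by (subst Bochner_Integration.integral_sum) (auto intro!: sum_bounded_above)
    then show ?thesis by (simp add: card_B)
  qed
  have EG: "(\<integral>\<omega>. G T j \<omega> \<partial>M) \<le> 2 * ((real (a T (Suc j)) - real (a T j)) * (C' / T + C / N))
      + 2 * (e * T + K j) + 1 + 2 * C * T / (real N)\<^sup>2" if T: "1 \<le> T" and j: "j < N" for T j
  proof -
    have "(\<integral>\<omega>. W j (a T i) \<omega> \<partial>M) \<le> e * T + K j" if "i \<le> N" for i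
    proof -
      have "e * a T i \<le> e * T" using a_le[OF that] e by (intro mult_left_mono) auto
      then show ?thesis using EW[OF j, of "a T i"] by linarith
    qed
    note this[of j] this[of "Suc j"]
    then show ?thesis unfolding G_def using iD[OF T j] iW[OF j] ED[OF T j] j by (simp add: prob_space)
  qed
  define L where "L = 2 * C' + 2 * (\<Sum>j<N. K j) + N + 1"
  show ?thesis
  proof (rule that[of R L])
    fix T :: nat assume T: "1 \<le> T"
    have iS: "integrable M (\<lambda>\<omega>. \<Sum>j<N. G T j \<omega>)"
      by (rule Bochner_Integration.integrable_sum) (simp add: iG[OF T])
    then show "integrable M (R T)" unfolding R_def by simp
    have "(\<integral>\<omega>. R T \<omega> \<partial>M) = ((\<Sum>j<N. \<integral>\<omega>. G T j \<omega> \<partial>M) + T / N + 1) / T + 1 / N"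
      unfolding R_def using iS iG[OF T] by (simp add: prob_space Bochner_Integration.integral_sum)
    also have "\<dots> \<le> ((\<Sum>j<N. 2 * ((real (a T (Suc j)) - real (a T j)) * (C' / T + C / N))
      + 2 * (e * T + K j) + 1 + 2 * C * T / (real N)\<^sup>2) + T / N + 1) / T + 1 / N"
      by (intro add_right_mono divide_right_mono sum_mono EG[OF T]) auto
    also have "(\<Sum>j<N. 2 * ((real (a T (Suc j)) - real (a T j)) * (C' / T + C / N))
        + 2 * (e * T + K j) + 1 + 2 * C * T / (real N)\<^sup>2)
      = 2 * ((\<Sum>j<N. real (a T (Suc j)) - real (a T j)) * (C' / T + C / N))
        + 2 * N * (e * T) + 2 * (\<Sum>j<N. K j) + N + N * (2 * C * T / (real N)\<^sup>2)"
      by (simp add: sum.distrib flip: sum_distrib_left sum_distrib_right)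
    also have "(\<Sum>j<N. real (a T (Suc j)) - real (a T j)) = T"
      using sum_lessThan_telescope[of "\<lambda>j. real (a T j)" N] N by (simp add: a_def)
    also have "2 * (T * (C' / T + C / N)) + 2 * N * (e * T) + 2 * (\<Sum>j<N. K j) + N + N * (2 * C * T / (real N)\<^sup>2)
        + T / N + 1 = T * ((4 * C + 1) / N + 2 * N * e) + L"
    proof -
      have "T * (C' / T + C / N) = C' + T * (C / N)" using T by (simp add: distrib_left)
      moreover have "N * (2 * C * T / (real N)\<^sup>2) = 2 * (T * (C / N))" using N by (simp add: power2_eq_square)
      moreover have "T * ((4 * C + 1) / N + 2 * N * e) = 4 * (T * (C / N)) + T / N + 2 * N * (e * T)"
        by (simp add: distrib_left add_divide_distrib)
      ultimately show ?thesis unfolding L_def by linarith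
    qed
    also have "(T * ((4 * C + 1) / N + 2 * N * e) + L) / T + 1 / N = (4 * C + 2) / N + 2 * N * e + L / T"
      using T by (simp add: add_divide_distrib)
    also have "2 * N * e = \<delta> / 2" using N by (simp add: e_def)
    also have "(4 * C + 2) / N + \<delta> / 2 + L / T \<le> \<delta> + L / T" using N(2) by linarith
    finally show "(\<integral>\<omega>. R T \<omega> \<partial>M) \<le> \<delta> + L / T" .
  next
    fix T :: nat and u :: real and \<omega> assume T: "1 \<le> T" and u: "u \<in> {0..1}"
    define k where "k = nat \<lfloor>u * N\<rfloor>"
    have "real k \<le> u * N" "u * N < real k + 1" using u by (auto simp: k_def)
    then have k: "k / N \<le> u" "u < k / N + 1 / N" using N by (auto simp: field_simps)
    have "real k \<le> 1 * N" using \<open>real k \<le> u * N\<close> mult_right_mono[of u 1 N] u by simp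
    then have kN: "k \<le> N" by simp
    have bl: "\<bar>(\<integral>x. f x \<partial>empirical_measure X T u \<omega>) - (\<integral>x. f x \<partial>limit_measure M Z u)\<bar> \<le> R T \<omega>"
      if f: "bl_norm f \<le> 1" for f
    proof -
      let ?I = "\<lambda>u. \<integral>x. f x \<partial>limit_measure M Z u" and ?S = "\<lambda>n. \<Sum>t\<in>{1..n}. f (X t T \<omega>)"
      have G: "\<bar>(\<Sum>t\<in>B T j. f (X t T \<omega>)) - T * (?I (Suc j / N) - ?I (j / N))\<bar> \<le> G T j \<omega>" if "j < N" for j
        unfolding G_def D_def B_def a_def
        by (rule block_estimate[OF f T that _ C(1) W[OF that f]]) (use C(2)[of 1] in auto)
      have I0: "?I 0 = 0"
      proof -
        have "AE \<eta> in lborel. indicator {0..0::real} \<eta> *\<^sub>R (\<integral>\<omega>. f (Z 1 \<eta> \<omega>) \<partial>M) = 0"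
          using AE_lborel_singleton[of "0::real"] by eventually_elim auto
        then have "(LINT \<eta>:{0..0}|lborel. \<integral>\<omega>. f (Z 1 \<eta> \<omega>) \<partial>M) = 0"
          unfolding set_lebesgue_integral_def by (rule integral_eq_zero_AE)
        with integral_limit_measure(2)[OF f, of 0] show ?thesis by simp
      qed
      have grid: "\<bar>?S (int (a T i)) - T * ?I (i / N)\<bar> \<le> (\<Sum>j<i. G T j \<omega>)" if "i \<le> N" for i
        using that
      proof (induction i)
        case 0
        then show ?case by (simp add: I0 a_def)
      next
        case (Suc i)
        have "{1..int (a T (Suc i))} = {1..int (a T i)} \<union> B T i" "{1..int (a T i)} \<inter> B T i = {}"
          using a_mono[of T i] by (auto simp: B_def)
        then have "?S (int (a T (Suc i))) = ?S (int (a T i)) + (\<Sum>t\<in>B T i. f (X t T \<omega>))"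
          by (simp add: sum.union_disjoint B_def)
        then show ?case using Suc.IH G[of i] Suc.prems
          by (simp add: right_diff_distrib)
      qed
      have G0: "0 \<le> G T j \<omega>" if "j < N" for j using G[OF that] by linarith
      have "(\<Sum>j<k. G T j \<omega>) \<le> (\<Sum>j<N. G T j \<omega>)"
        using kN G0 by (intro sum_mono2) auto
      with grid[OF kN] have 1: "\<bar>?S (int (a T k)) - T * ?I (k / N)\<bar> \<le> (\<Sum>j<N. G T j \<omega>)" by linarith
      have 2: "\<bar>?I u - ?I (k / N)\<bar> \<le> 1 / N"
      proof -
        have k0: "0 \<le> real k / real N" by simp
        have c: "\<bar>(\<integral>\<omega>. f (Z 1 \<eta> \<omega>) \<partial>M) - 0\<bar> \<le> 1" if "\<eta> \<in> {k / N..u}" for \<eta>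
        proof -
          have "\<eta> \<in> {0..1}" using that u k0 unfolding atLeastAtMost_iff by linarith
          then show ?thesis using bl_aux_integrable(2)[OF f, of \<eta> 1] by simp
        qed
        have "\<bar>?I u - ?I (k / N) - (u - k / N) * 0\<bar> \<le> (u - k / N) * 1"
          by (rule integral_limit_measure_increment[OF f k0 k(1) _ c]) (use u in auto)
        then show ?thesis using k by simp
      qed
      have ak: "a T k \<le> k * T / N" "k * T / N < real (a T k) + 1" unfolding a_def by (rule real_div_bounds[OF N(1)])+
      have "k * T / N \<le> u * T" using mult_right_mono[OF k(1), of T] by simp
      then have "real_of_int (int (a T k)) \<le> u * T" using ak by simp
      then have le: "int (a T k) \<le> \<lfloor>u * T\<rfloor>" by (simp only: le_floor_iff)
      have "\<bar>?S \<lfloor>u * T\<rfloor> - ?S (int (a T k))\<bar> \<le> T / N + 1"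
      proof -
        have "{1..\<lfloor>u * T\<rfloor>} = {1..int (a T k)} \<union> {int (a T k) + 1..\<lfloor>u * T\<rfloor>}"
          "{1..int (a T k)} \<inter> {int (a T k) + 1..\<lfloor>u * T\<rfloor>} = {}" using le by auto
        then have "\<bar>?S \<lfloor>u * T\<rfloor> - ?S (int (a T k))\<bar> = \<bar>\<Sum>t\<in>{int (a T k) + 1..\<lfloor>u * T\<rfloor>}. f (X t T \<omega>)\<bar>"
          by (simp add: sum.union_disjoint)
        also have "\<dots> \<le> (\<Sum>t\<in>{int (a T k) + 1..\<lfloor>u * T\<rfloor>}. 1)"
          by (rule order_trans[OF sum_abs sum_mono]) (rule bl_norm_le_1D(1)[OF f])
        also have "\<dots> = real_of_int (\<lfloor>u * T\<rfloor> - int (a T k))" using le by simp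
        also have "\<dots> \<le> u * T - a T k" by simp
        also have "\<dots> \<le> (k / N + 1 / N) * T - (k * T / N - 1)"
          using mult_right_mono[of u "k / N + 1 / N" T] k ak by simp
        finally show ?thesis by (simp add: field_simps)
      qed
      with 1 have "\<bar>?S \<lfloor>u * T\<rfloor> - T * ?I (k / N)\<bar> \<le> (\<Sum>j<N. G T j \<omega>) + T / N + 1" by linarith
      then have "\<bar>?S \<lfloor>u * T\<rfloor> - T * ?I (k / N)\<bar> / T \<le> ((\<Sum>j<N. G T j \<omega>) + T / N + 1) / T"
        by (rule divide_right_mono) simp
      moreover have "?S \<lfloor>u * T\<rfloor> / T - ?I (k / N) = (?S \<lfloor>u * T\<rfloor> - T * ?I (k / N)) / T"
        using T by (simp add: diff_divide_distrib)
      ultimately have "\<bar>?S \<lfloor>u * T\<rfloor> / T - ?I (k / N)\<bar> \<le> ((\<Sum>j<N. G T j \<omega>) + T / N + 1) / T"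
        by simp
      then show ?thesis
        using 2 unfolding R_def integral_empirical_measure[OF bl_norm_borel[OF f]] by linarith
    qed
    have "bl_norm (\<lambda>x::'a. 0) \<le> 1" by (rule bl_norm_le_1I[of _ 0 0]) auto
    then have "0 \<le> R T \<omega>" using bl[of "\<lambda>x. 0"] by simp
    then show "bl_dist (empirical_measure X T u \<omega>) (limit_measure M Z u) \<le> R T \<omega>"
      by (intro bl_dist_le bl)
  qed
qed

end

section \<open>Weak convergence in the Skorokhod space\<close>

lemma sets_borel_of: "sets (borel_of Y) = sigma_sets (topspace Y) {U. openin Y U}"
  and space_borel_of: "space (borel_of Y) = topspace Y"
proof -
  have *: "{U. openin Y U} \<subseteq> Pow (topspace Y)" by (auto dest: openin_subset)
  show "sets (borel_of Y) = sigma_sets (topspace Y) {U. openin Y U}"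
    unfolding borel_of_def using * by (rule sets_measure_of)
  show "space (borel_of Y) = topspace Y"
    unfolding borel_of_def using * by (rule space_measure_of)
qed

lemma measurable_borel_ofI:
  assumes "\<And>\<omega>. \<omega> \<in> space M \<Longrightarrow> g \<omega> \<in> topspace Y"
    and "\<And>U. openin Y U \<Longrightarrow> g -` U \<inter> space M \<in> sets M"
  shows "g \<in> M \<rightarrow>\<^sub>M borel_of Y"
  unfolding borel_of_def
  by (rule measurable_measure_of) (use assms in \<open>auto dest: openin_subset\<close>)

lemma measurable_continuous_map_borel_of:
  assumes "continuous_map Y euclideanreal f"
  shows "f \<in> borel_of Y \<rightarrow>\<^sub>M borel"
proof (rule borel_measurableI)
  fix S :: "real set" assume "open S"
  then have "openin Y {x \<in> topspace Y. f x \<in> S}"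
    using assms by (simp add: continuous_map_def)
  moreover have "f -` S \<inter> space (borel_of Y) = {x \<in> topspace Y. f x \<in> S}"
    by (auto simp: space_borel_of)
  ultimately show "f -` S \<inter> space (borel_of Y) \<in> sets (borel_of Y)"
    unfolding sets_borel_of by (auto intro: sigma_sets.Basic)
qed

text \<open>Where \<open>\<xi> n\<close> is within \<open>r\<close> of \<open>c\<close>, continuity of \<open>f\<close> at \<open>c\<close> controls \<open>f (\<xi> n) - f c\<close>; elsewhere
  boundedness of \<open>f\<close> does, on an event of small probability.\<close>

lemma converges_weakly_to_constant:
  assumes "prob_space M" and "Metric_space S d" and c: "c \<in> S"
    and meas: "\<And>n. \<xi> n \<in> M \<rightarrow>\<^sub>M borel_of (Metric_space.mtopology S d)"
    and prob0: "\<And>r. 0 < r \<Longrightarrow> (\<lambda>n. measure M {\<omega> \<in> space M. r \<le> d c (\<xi> n \<omega>)}) \<longlonglongrightarrow> 0"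
  shows "converges_weakly M (Metric_space.mtopology S d) \<xi> (\<lambda>_. c)"
proof -
  interpret prob_space M by fact
  interpret S: Metric_space S d by fact
  have \<xi>S: "\<xi> n \<omega> \<in> S" if "\<omega> \<in> space M" for n \<omega>
    using measurable_space[OF meas that] by (simp add: space_borel_of)
  have "(\<lambda>n. \<integral>\<omega>. f (\<xi> n \<omega>) \<partial>M) \<longlonglongrightarrow> (\<integral>\<omega>. f c \<partial>M)"
    if f: "continuous_map S.mtopology euclideanreal f" and bdd: "bounded (f ` topspace S.mtopology)" for f
  proof (rule LIMSEQ_I)
    fix e :: real assume e: "0 < e"
    obtain B where B: "\<And>x. x \<in> S \<Longrightarrow> \<bar>f x\<bar> \<le> B" using bdd unfolding bounded_iff by auto
    have B0: "0 \<le> B" using B[OF c] by linarith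
    have fm: "(\<lambda>\<omega>. f (\<xi> n \<omega>)) \<in> borel_measurable M" for n
      using measurable_compose[OF meas measurable_continuous_map_borel_of[OF f]] .
    have fi: "integrable M (\<lambda>\<omega>. f (\<xi> n \<omega>))" for n
      by (rule integrable_const_bound[of _ B]) (use fm B \<xi>S in \<open>auto intro!: AE_I2\<close>)
    have "openin S.mtopology {x \<in> topspace S.mtopology. f x \<in> ball (f c) (e / 2)}"
      by (rule openin_continuous_map_preimage[OF f]) simp
    moreover have "c \<in> {x \<in> topspace S.mtopology. f x \<in> ball (f c) (e / 2)}" using c e by simp
    ultimately obtain r where r: "0 < r" "S.mball c r \<subseteq> {x \<in> topspace S.mtopology. f x \<in> ball (f c) (e / 2)}"
      unfolding S.openin_mtopology by blast
    define A where "A n = {\<omega> \<in> space M. r \<le> d c (\<xi> n \<omega>)}" for n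
    have A: "A n \<in> sets M" for n
    proof -
      have "S.mball c r \<in> sets (borel_of S.mtopology)"
        unfolding sets_borel_of by (rule sigma_sets.Basic) (simp add: S.openin_mball)
      then have "space M - (\<xi> n -` S.mball c r \<inter> space M) \<in> sets M"
        using measurable_sets[OF meas] by blast
      also have "space M - (\<xi> n -` S.mball c r \<inter> space M) = A n"
        using c \<xi>S by (auto simp: A_def S.in_mball not_less)
      finally show ?thesis .
    qed
    have "(\<lambda>n. prob (A n)) \<longlonglongrightarrow> 0" unfolding A_def using r(1) by (rule prob0)
    then have "(\<lambda>n. 2 * B * prob (A n)) \<longlonglongrightarrow> 0" by (rule tendsto_mult_right_zero)
    then have "\<forall>\<^sub>F n in sequentially. 2 * B * prob (A n) < e / 2"
      using e by (intro order_tendstoD(2)) auto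
    then obtain n0 where n0: "\<And>n. n \<ge> n0 \<Longrightarrow> 2 * B * prob (A n) < e / 2"
      by (auto simp: eventually_sequentially)
    have "norm ((\<integral>\<omega>. f (\<xi> n \<omega>) \<partial>M) - (\<integral>\<omega>. f c \<partial>M)) < e" if "n \<ge> n0" for n
    proof -
      have "\<bar>(\<integral>\<omega>. f (\<xi> n \<omega>) \<partial>M) - (\<integral>\<omega>. f c \<partial>M)\<bar> = \<bar>\<integral>\<omega>. f (\<xi> n \<omega>) - f c \<partial>M\<bar>" using fi by simp
      also have "\<dots> \<le> (\<integral>\<omega>. \<bar>f (\<xi> n \<omega>) - f c\<bar> \<partial>M)" by (rule integral_abs_bound)
      also have "\<dots> \<le> (\<integral>\<omega>. e / 2 + 2 * B * indicat_real (A n) \<omega> \<partial>M)"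
      proof (rule integral_mono)
        fix \<omega> assume \<omega>: "\<omega> \<in> space M"
        show "\<bar>f (\<xi> n \<omega>) - f c\<bar> \<le> e / 2 + 2 * B * indicat_real (A n) \<omega>"
        proof (cases "\<omega> \<in> A n")
          case True
          then show ?thesis using B[OF c] B[OF \<xi>S[OF \<omega>, of n]] e by simp
        next
          case False
          then have "\<xi> n \<omega> \<in> S.mball c r" using \<omega> c \<xi>S by (auto simp: A_def S.in_mball)
          then have "f (\<xi> n \<omega>) \<in> ball (f c) (e / 2)" using r(2) by blast
          then show ?thesis using False by (simp add: dist_real_def abs_minus_commute)
        qed
      qed (use fi A in \<open>auto intro!: integrable_mult_right simp: less_top[symmetric]\<close>)
      also have "\<dots> = e / 2 + 2 * B * prob (A n)"
        using A by (subst Bochner_Integration.integral_add) (auto simp: prob_space less_top[symmetric])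
      also have "\<dots> < e" using n0[OF that] by simp
      finally show ?thesis by simp
    qed
    then show "\<exists>n0. \<forall>n\<ge>n0. norm ((\<integral>\<omega>. f (\<xi> n \<omega>) \<partial>M) - (\<integral>\<omega>. f c \<partial>M)) < e" by blast
  qed
  moreover have "(\<lambda>_. c) \<in> M \<rightarrow>\<^sub>M borel_of S.mtopology"
    by (rule measurable_const) (simp add: space_borel_of c)
  ultimately show ?thesis unfolding converges_weakly_def using meas by blast
qed

lemma skorokhod_dist_le_sup:
  assumes "\<And>u. u \<in> {0..1} \<Longrightarrow> d (x u) (y u) \<le> c" "0 \<le> c"
  shows "skorokhod_dist d x y \<le> c"
  by (rule skorokhod_dist_le[OF time_changes_id]) (use assms in auto)

lemma empirical_measure_floor_cong:
  "\<lfloor>u * real T\<rfloor> = \<lfloor>v * real T\<rfloor> \<Longrightarrow> empirical_measure X T u \<omega> = empirical_measure X T v \<omega>"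
  by (simp add: empirical_measure_def)

text \<open>The path depends on \<open>u\<close> through \<open>\<lfloor>u * T\<rfloor>\<close> only, so it is constant on a right neighbourhood of each
  point, with the value there, and on a left neighbourhood as well.\<close>

lemma empirical_path_cadlag:
  fixes X :: "int \<Rightarrow> nat \<Rightarrow> 'w \<Rightarrow> 'a::metric_space"
  assumes T: "1 \<le> T"
  shows "empirical_path X T \<omega> \<in> cadlag_paths bl_topology"
proof -
  let ?p = "empirical_path X T \<omega>"
  have mem: "?p u \<in> subprobs" if "u \<in> {0..1}" for u
    using empirical_measure_subprob[OF T that] that by simp
  have T0: "0 < real T" using T by simp
  have "limitin bl_topology ?p (?p t) (at_right t)" if t: "t \<in> {0..<1}" for t
  proof (rule limitin_eventually)
    show "?p t \<in> topspace bl_topology" using mem[of t] t by (simp add: topspace_bl_topology)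
    define b where "b = min 1 ((\<lfloor>t * T\<rfloor> + 1) / T)"
    have "t * T < \<lfloor>t * T\<rfloor> + 1" by linarith
    then have "t < b" using t T0 by (simp add: b_def less_divide_eq)
    moreover have "?p u = ?p t" if "t < u" "u < b" for u
    proof -
      have "u * T < \<lfloor>t * T\<rfloor> + 1" using that(2) T0 by (simp add: b_def less_divide_eq)
      moreover have "t * T \<le> u * T" using that(1) T0 by simp
      ultimately have "\<lfloor>u * T\<rfloor> = \<lfloor>t * T\<rfloor>" by linarith
      then show ?thesis using that t empirical_measure_floor_cong[of u T t X \<omega>] by (simp add: b_def)
    qed
    ultimately show "\<forall>\<^sub>F u in at_right t. ?p u = ?p t"
      unfolding eventually_at_right_field by blast
  qed
  moreover have "\<exists>l. limitin bl_topology ?p l (at_left t)" if t: "t \<in> {0<..1}" for t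
  proof (rule exI, rule limitin_eventually)
    \<comment> \<open>the last grid point strictly before \<open>t\<close>\<close>
    define b where "b = (\<lceil>t * T\<rceil> - 1) / T"
    have "0 < t * T" "t * T \<le> T" using t T0 by auto
    then have "1 \<le> \<lceil>t * T\<rceil>" "real_of_int \<lceil>t * T\<rceil> - 1 < t * T" by linarith+
    then have b: "0 \<le> b" "b < t" using T0 by (auto simp: b_def divide_less_eq)
    then have b01: "b \<in> {0..1}" using t by auto
    show "?p b \<in> topspace bl_topology" using mem[OF b01] by (simp only: topspace_bl_topology)
    have bT: "b * T = \<lceil>t * T\<rceil> - 1" using T0 by (simp add: b_def)
    have "?p u = ?p b" if "b < u" "u < t" for u
    proof -
      have "b * T < u * T" "u * T < t * T" using that T0 by auto
      then have "\<lfloor>u * T\<rfloor> = \<lceil>t * T\<rceil> - 1" unfolding bT by linarith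
      then have "\<lfloor>u * T\<rfloor> = \<lfloor>b * T\<rfloor>" by (simp only: bT floor_of_int)
      then show ?thesis using that t b b01 empirical_measure_floor_cong[of u T b X \<omega>] by simp
    qed
    then show "\<forall>\<^sub>F u in at_left t. ?p u = ?p b"
      unfolding eventually_at_left_field using b(2) by blast
  qed
  moreover have "?p \<in> {0..1} \<rightarrow>\<^sub>E topspace bl_topology"
    unfolding topspace_bl_topology using mem by auto
  ultimately show ?thesis unfolding cadlag_paths_def by blast
qed

lemma bl_dist_empirical_measure_le:
  fixes X :: "int \<Rightarrow> nat \<Rightarrow> 'w \<Rightarrow> 'a::metric_space"
  assumes T: "1 \<le> T" and u: "u \<in> {0..1}"
  shows "bl_dist (empirical_measure X T u \<omega>) (empirical_measure X' T u \<omega>')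
    \<le> 2 * (\<Sum>t\<in>{1..int T}. min (dist (X t T \<omega>) (X' t T \<omega>')) 1)"
proof (rule bl_dist_le)
  have "u * real T \<le> 1 * real T" using u by (intro mult_right_mono) auto
  then have "\<lfloor>u * T\<rfloor> \<le> int T" by (simp add: floor_le_iff)
  then have sub: "{1..\<lfloor>u * T\<rfloor>} \<subseteq> {1..int T}" by auto
  fix f :: "'a \<Rightarrow> real" assume f: "bl_norm f \<le> 1"
  let ?s = "\<Sum>t\<in>{1..\<lfloor>u * T\<rfloor>}. f (X t T \<omega>) - f (X' t T \<omega>')"
  have "\<bar>(\<integral>x. f x \<partial>empirical_measure X T u \<omega>) - (\<integral>x. f x \<partial>empirical_measure X' T u \<omega>')\<bar> = \<bar>?s\<bar> / T"
    by (simp add: integral_empirical_measure[OF bl_norm_borel[OF f]] sum_subtractf flip: diff_divide_distrib)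
  also have "\<dots> \<le> \<bar>?s\<bar>" using T by (simp add: divide_le_eq mult_left_le_one_le mult_le_cancel_left1)
  also have "\<dots> \<le> (\<Sum>t\<in>{1..\<lfloor>u * T\<rfloor>}. 2 * min (dist (X t T \<omega>) (X' t T \<omega>')) 1)"
    by (rule order_trans[OF sum_abs sum_mono]) (rule bl_norm_le_1_min_dist[OF f])
  also have "\<dots> \<le> (\<Sum>t\<in>{1..int T}. 2 * min (dist (X t T \<omega>) (X' t T \<omega>')) 1)"
    using sub by (intro sum_mono2) auto
  finally show "\<bar>(\<integral>x. f x \<partial>empirical_measure X T u \<omega>) - (\<integral>x. f x \<partial>empirical_measure X' T u \<omega>')\<bar>
      \<le> 2 * (\<Sum>t\<in>{1..int T}. min (dist (X t T \<omega>) (X' t T \<omega>')) 1)" by (simp add: sum_distrib_left)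
qed (auto intro!: sum_nonneg)

text \<open>The path is a continuous function of the sample, because the jump times are fixed.  Preimages of open sets
  are therefore open in the countable product of copies of the state space, whose open sets belong
  to the product sigma-algebra by separability.\<close>

lemma measurable_empirical_path:
  fixes X :: "int \<Rightarrow> nat \<Rightarrow> 'w \<Rightarrow> 'a::polish_space"
  assumes T: "1 \<le> T" and X: "\<And>t. X t T \<in> borel_measurable M"
  shows "empirical_path X T \<in> M \<rightarrow>\<^sub>M borel_of skorokhod_topology"
proof (rule measurable_borel_ofI)
  show "empirical_path X T \<omega> \<in> topspace skorokhod_topology" for \<omega>
    unfolding topspace_skorokhod_topology by (rule empirical_path_cadlag[OF T])
  interpret D: Metric_space "cadlag_paths (bl_topology :: 'a measure topology)" "skorokhod_dist bl_dist"
    by (rule Metric_space_skorokhod)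
  fix U :: "(real \<Rightarrow> 'a measure) set" assume U: "openin skorokhod_topology U"
  define H :: "(int \<Rightarrow> 'a) \<Rightarrow> real \<Rightarrow> 'a measure" where "H = empirical_path (\<lambda>t _ x. x t) T"
  have H: "H x \<in> cadlag_paths bl_topology" for x unfolding H_def by (rule empirical_path_cadlag[OF T])
  have "open (H -` U)"
  proof (rule topological_space_class.openI)
    fix x assume "x \<in> H -` U"
    then obtain r where r: "0 < r" "D.mball (H x) r \<subseteq> U" using U unfolding D.openin_mtopology by auto
    let ?V = "{y. 2 * (\<Sum>t\<in>{1..int T}. min (dist (x t) (y t)) 1) < r}"
    have "open ?V"
      by (intro open_Collect_less continuous_intros continuous_on_product_coordinates)
    moreover have "x \<in> ?V" using r(1) by simp
    moreover have "?V \<subseteq> H -` U"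
    proof
      fix y assume y: "y \<in> ?V"
      have "skorokhod_dist bl_dist (H x) (H y) \<le> 2 * (\<Sum>t\<in>{1..int T}. min (dist (x t) (y t)) 1)"
        unfolding H_def
        by (rule skorokhod_dist_le_sup)
          (use bl_dist_empirical_measure_le[OF T, of _ "\<lambda>t _ x. x t" x "\<lambda>t _ x. x t" y] in \<open>auto intro!: sum_nonneg\<close>)
      then have "H y \<in> D.mball (H x) r" using y H by (simp add: D.in_mball)
      then show "y \<in> H -` U" using r(2) by auto
    qed
    ultimately show "\<exists>V. open V \<and> x \<in> V \<and> V \<subseteq> H -` U" by blast
  qed
  then have "H -` U \<in> sets (path_space :: (int \<Rightarrow> 'a) measure)" by (simp add: sets_PiM_equal_borel)
  moreover have "(\<lambda>\<omega> t. X t T \<omega>) \<in> M \<rightarrow>\<^sub>M path_space" by (rule measurable_path) (rule X)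
  ultimately have "(\<lambda>\<omega> t. X t T \<omega>) -` (H -` U) \<inter> space M \<in> sets M" by (metis measurable_sets)
  also have "(\<lambda>\<omega> t. X t T \<omega>) -` (H -` U) = empirical_path X T -` U"
    by (auto simp: H_def empirical_measure_def)
  finally show "empirical_path X T -` U \<inter> space M \<in> sets M" .
qed

theorem theorem3p2:
  fixes M :: "'w measure"
    and X :: "int \<Rightarrow> nat \<Rightarrow> 'w \<Rightarrow> 'a::polish_space"
    and Z :: "int \<Rightarrow> real \<Rightarrow> 'w \<Rightarrow> 'a"
  assumes "prob_space M"
    and "locally_stationary M X Z"
    and "\<And>u. u \<in> {0..1} \<Longrightarrow> ergodic M (\<lambda>t. Z t u)"
  shows "converges_weakly M skorokhod_topology (\<lambda>n. empirical_path X (Suc n)) (\<lambda>\<omega>. limit_path M Z)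
    \<and> (AE \<omega> in M. limit_path M Z \<in> continuous_paths bl_topology)"
proof
  interpret prob_space M by fact
  have cont: "limit_path M Z \<in> continuous_paths bl_topology"
    by (rule limit_path_continuous[OF assms(1,2)])
  then show "AE \<omega> in M. limit_path M Z \<in> continuous_paths bl_topology" by simp
  show "converges_weakly M skorokhod_topology (\<lambda>n. empirical_path X (Suc n)) (\<lambda>\<omega>. limit_path M Z)"
  proof (rule converges_weakly_to_constant[OF assms(1) Metric_space_skorokhod])
    show "limit_path M Z \<in> cadlag_paths bl_topology"
      using cont continuous_paths_subset_cadlag_paths by blast
    show "empirical_path X (Suc n) \<in> M \<rightarrow>\<^sub>M borel_of skorokhod_topology" for n
      by (intro measurable_empirical_path measurable_array[OF assms(1,2)]) auto
    fix r :: real assume r: "0 < r"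
    define P where "P n = prob {\<omega> \<in> space M. r \<le> skorokhod_dist bl_dist (limit_path M Z) (empirical_path X (Suc n) \<omega>)}" for n
    have "P \<longlonglongrightarrow> 0"
    proof (rule LIMSEQ_I)
      fix e :: real assume e: "0 < e"
      then have "0 < r * e / 2" using r by simp
      from uniform_bound_in_mean[OF assms(1,2,3) this]
      obtain R :: "nat \<Rightarrow> 'w \<Rightarrow> real" and K where
        iR: "\<And>T. 1 \<le> T \<Longrightarrow> integrable M (R T)" and
        R: "\<And>T u \<omega>. 1 \<le> T \<Longrightarrow> u \<in> {0..1} \<Longrightarrow>
          bl_dist (empirical_measure X T u \<omega>) (limit_measure M Z u) \<le> R T \<omega>" and
        ER: "\<And>T. 1 \<le> T \<Longrightarrow> (\<integral>\<omega>. R T \<omega> \<partial>M) \<le> r * e / 2 + K / T"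
        by blast
      obtain n0 :: nat where n0: "2 * K / (r * e) < n0" using reals_Archimedean2 by blast
      have "norm (P n - 0) < e" if n: "n \<ge> n0" for n
      proof -
        have R0: "0 \<le> R (Suc n) \<omega>" for \<omega>
          using R[of "Suc n" 0 \<omega>] by (auto intro: order_trans[OF bl_dist_nonneg])
        have "skorokhod_dist bl_dist (limit_path M Z) (empirical_path X (Suc n) \<omega>) \<le> R (Suc n) \<omega>" for \<omega>
          by (rule skorokhod_dist_le_sup) (use R[of "Suc n" _ \<omega>] R0 in \<open>auto simp: bl_dist_commute\<close>)
        then have "P n \<le> prob {\<omega> \<in> space M. r \<le> R (Suc n) \<omega>}"
          unfolding P_def using borel_measurable_integrable[OF iR[of "Suc n"]]
          by (intro finite_measure_mono) (auto intro: order_trans)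
        also have "\<dots> \<le> (\<integral>\<omega>. R (Suc n) \<omega> \<partial>M) / r"
          by (rule integral_Markov_inequality_measure[where A="space M"]) (use iR R0 r in auto)
        also have "\<dots> \<le> (r * e / 2 + K / real (Suc n)) / r"
          using ER[of "Suc n"] r by (intro divide_right_mono) auto
        also have "\<dots> < e"
        proof -
          have "2 * K / (r * e) < real (Suc n)" using n0 n by linarith
          then have "K / real (Suc n) < r * e / 2" using r e by (simp add: field_simps)
          moreover have "y / 2 + x < y" if "x < y / 2" for x y :: real using that by linarith
          ultimately have "r * e / 2 + K / real (Suc n) < r * e" by blast
          then show ?thesis by (subst pos_divide_less_eq[OF r]) (simp only: mult.commute)
        qed
        finally show ?thesis by (simp add: P_def)
      qed
      then show "\<exists>n0. \<forall>n\<ge>n0. norm (P n - 0) < e" by blast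
    qed
    then show "(\<lambda>n. prob {\<omega> \<in> space M. r \<le> skorokhod_dist bl_dist (limit_path M Z) (empirical_path X (Suc n) \<omega>)}) \<longlonglongrightarrow> 0"
      unfolding P_def .
  qed
qed

end
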